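(* Every nilpotent prelinear cancellative residuated lattice is semilinear.
   Context: A residuated lattice is an algebra $\mathbf{L}=\langle L,\wedge,\vee,\cdot,\backslash,/,\mathrm{e}\rangle$ such that $\langle L,\cdot,\mathrm{e}\rangle$ is a monoid, $\langle L,\wedge,\vee\rangle$ is a lattice, and for all $a,b,d\in L$: $ab\le d \iff a\le d/b \iff b\le a\backslash d$. It is cancellative if its monoid reduct is a cancellative monoid. It is prelinear if it satisfies both $(x\backslash y\wedge \mathrm{e})\vee(y\backslash x\wedge \mathrm{e})\approx \mathrm{e}$ and $(x/y\wedge \mathrm{e})\vee(y/x\wedge \mathrm{e})\approx \mathrm{e}$ (residuals bind more strongly than $\wedge,\vee$). It is semilinear if it is (isomorphic to) a subdirect product of totally ordered residuated lattices. Define monoid terms $q_c(x,y,\bar z)$ for $c\ge 1$, with $\bar z=z_1,z_2,\dots$, by $q_1(x,y,\bar z)=xy$ and $q_{c+1}(x,y,\bar z)=q_c(x,y,\bar z)\,z_c\,q_c(y,x,\bar z)$. A residuated lattice is $c$-nilpotent if its monoid reduct satisfies the equation $q_c(x,y,\bar z)\approx q_c(y,x,\bar z)$, and nilpotent if it is $c$-nilpotent for some integer $c\ge 1$. *)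

theory Defs
  imports "HOL-Algebra.Divisibility"
begin

section \<open>Residuated lattices\<close>

text \<open>The symbols for meet and join differ from those of \<^theory>\<open>HOL-Algebra.Lattice\<close>, where they
  are derived from an order instead of being fundamental operations.\<close>

record 'a residuated_lattice = "'a monoid" +
  rl_meet :: "'a \<Rightarrow> 'a \<Rightarrow> 'a" (infixl \<open>\<^bold>\<and>\<index>\<close> 66)
  rl_join :: "'a \<Rightarrow> 'a \<Rightarrow> 'a" (infixl \<open>\<^bold>\<or>\<index>\<close> 65)
  lres :: "'a \<Rightarrow> 'a \<Rightarrow> 'a" (infix \<open>\<setminus>\<index>\<close> 68)
  rres :: "'a \<Rightarrow> 'a \<Rightarrow> 'a" (infix \<open>\<^bold>'/\<index>\<close> 68)

definition rl_le :: "('a, 'm) residuated_lattice_scheme \<Rightarrow> 'a \<Rightarrow> 'a \<Rightarrow> bool" (infix \<open>\<preceq>\<index>\<close> 50)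
  where "a \<preceq>\<^bsub>L\<^esub> b \<longleftrightarrow> a \<^bold>\<and>\<^bsub>L\<^esub> b = a"

locale residuated_lattice = monoid L for L (structure) +
  assumes meet_closed: "\<lbrakk>a \<in> carrier L; b \<in> carrier L\<rbrakk> \<Longrightarrow> a \<^bold>\<and> b \<in> carrier L"
    and join_closed: "\<lbrakk>a \<in> carrier L; b \<in> carrier L\<rbrakk> \<Longrightarrow> a \<^bold>\<or> b \<in> carrier L"
    and lres_closed: "\<lbrakk>a \<in> carrier L; b \<in> carrier L\<rbrakk> \<Longrightarrow> a \<setminus> b \<in> carrier L"
    and rres_closed: "\<lbrakk>a \<in> carrier L; b \<in> carrier L\<rbrakk> \<Longrightarrow> a \<^bold>/ b \<in> carrier L"
    and meet_assoc: "\<lbrakk>a \<in> carrier L; b \<in> carrier L; d \<in> carrier L\<rbrakk>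
          \<Longrightarrow> (a \<^bold>\<and> b) \<^bold>\<and> d = a \<^bold>\<and> (b \<^bold>\<and> d)"
    and meet_comm: "\<lbrakk>a \<in> carrier L; b \<in> carrier L\<rbrakk> \<Longrightarrow> a \<^bold>\<and> b = b \<^bold>\<and> a"
    and join_assoc: "\<lbrakk>a \<in> carrier L; b \<in> carrier L; d \<in> carrier L\<rbrakk>
          \<Longrightarrow> (a \<^bold>\<or> b) \<^bold>\<or> d = a \<^bold>\<or> (b \<^bold>\<or> d)"
    and join_comm: "\<lbrakk>a \<in> carrier L; b \<in> carrier L\<rbrakk> \<Longrightarrow> a \<^bold>\<or> b = b \<^bold>\<or> a"
    and meet_absorb: "\<lbrakk>a \<in> carrier L; b \<in> carrier L\<rbrakk> \<Longrightarrow> a \<^bold>\<and> (a \<^bold>\<or> b) = a"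
    and join_absorb: "\<lbrakk>a \<in> carrier L; b \<in> carrier L\<rbrakk> \<Longrightarrow> a \<^bold>\<or> (a \<^bold>\<and> b) = a"
    and rres_adjoint: "\<lbrakk>a \<in> carrier L; b \<in> carrier L; d \<in> carrier L\<rbrakk>
          \<Longrightarrow> a \<otimes> b \<preceq> d \<longleftrightarrow> a \<preceq> d \<^bold>/ b"
    and lres_adjoint: "\<lbrakk>a \<in> carrier L; b \<in> carrier L; d \<in> carrier L\<rbrakk>
          \<Longrightarrow> a \<otimes> b \<preceq> d \<longleftrightarrow> b \<preceq> a \<setminus> d"

text \<open>For cancellativity of the monoid reduct we use \<^locale>\<open>monoid_cancel\<close>.\<close>

definition prelinear :: "('a, 'm) residuated_lattice_scheme \<Rightarrow> bool" where
  "prelinear L \<longleftrightarrow> (\<forall>x\<in>carrier L. \<forall>y\<in>carrier L.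
     (x \<setminus>\<^bsub>L\<^esub> y \<^bold>\<and>\<^bsub>L\<^esub> \<one>\<^bsub>L\<^esub>) \<^bold>\<or>\<^bsub>L\<^esub> (y \<setminus>\<^bsub>L\<^esub> x \<^bold>\<and>\<^bsub>L\<^esub> \<one>\<^bsub>L\<^esub>) = \<one>\<^bsub>L\<^esub> \<and>
     (x \<^bold>/\<^bsub>L\<^esub> y \<^bold>\<and>\<^bsub>L\<^esub> \<one>\<^bsub>L\<^esub>) \<^bold>\<or>\<^bsub>L\<^esub> (y \<^bold>/\<^bsub>L\<^esub> x \<^bold>\<and>\<^bsub>L\<^esub> \<one>\<^bsub>L\<^esub>) = \<one>\<^bsub>L\<^esub>)"

definition totally_ordered :: "('a, 'm) residuated_lattice_scheme \<Rightarrow> bool" where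
  "totally_ordered L \<longleftrightarrow> (\<forall>a\<in>carrier L. \<forall>b\<in>carrier L. a \<preceq>\<^bsub>L\<^esub> b \<or> b \<preceq>\<^bsub>L\<^esub> a)"


section \<open>Nilpotency\<close>

text \<open>The value of the monoid term $q_c$ under an assignment of its variables; the values at
  index \<open>c = 0\<close> are irrelevant.\<close>

fun qterm :: "('a, 'm) monoid_scheme \<Rightarrow> nat \<Rightarrow> 'a \<Rightarrow> 'a \<Rightarrow> (nat \<Rightarrow> 'a) \<Rightarrow> 'a" where
  "qterm L 0 x y z = undefined"
| "qterm L (Suc 0) x y z = x \<otimes>\<^bsub>L\<^esub> y"
| "qterm L (Suc (Suc c)) x y z =
     qterm L (Suc c) x y z \<otimes>\<^bsub>L\<^esub> z (Suc c) \<otimes>\<^bsub>L\<^esub> qterm L (Suc c) y x z"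

definition c_nilpotent :: "nat \<Rightarrow> ('a, 'm) monoid_scheme \<Rightarrow> bool" where
  "c_nilpotent c L \<longleftrightarrow> (\<forall>x\<in>carrier L. \<forall>y\<in>carrier L. \<forall>z\<in>UNIV \<rightarrow> carrier L.
     qterm L c x y z = qterm L c y x z)"

definition nilpotent :: "('a, 'm) monoid_scheme \<Rightarrow> bool" where
  "nilpotent L \<longleftrightarrow> (\<exists>c\<ge>1. c_nilpotent c L)"


section \<open>Subdirect products and semilinearity\<close>

definition rl_iso :: "('a, 'm) residuated_lattice_scheme \<Rightarrow> ('b, 'n) residuated_lattice_scheme
    \<Rightarrow> ('a \<Rightarrow> 'b) set" where
  "rl_iso L M = {h. bij_betw h (carrier L) (carrier M) \<and> h \<one>\<^bsub>L\<^esub> = \<one>\<^bsub>M\<^esub> \<and>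
     (\<forall>a\<in>carrier L. \<forall>b\<in>carrier L.
        h (a \<otimes>\<^bsub>L\<^esub> b) = h a \<otimes>\<^bsub>M\<^esub> h b \<and>
        h (a \<^bold>\<and>\<^bsub>L\<^esub> b) = h a \<^bold>\<and>\<^bsub>M\<^esub> h b \<and>
        h (a \<^bold>\<or>\<^bsub>L\<^esub> b) = h a \<^bold>\<or>\<^bsub>M\<^esub> h b \<and>
        h (a \<setminus>\<^bsub>L\<^esub> b) = h a \<setminus>\<^bsub>M\<^esub> h b \<and>
        h (a \<^bold>/\<^bsub>L\<^esub> b) = h a \<^bold>/\<^bsub>M\<^esub> h b)}"

definition rl_product :: "'i set \<Rightarrow> ('i \<Rightarrow> ('b, 'm) residuated_lattice_scheme)
    \<Rightarrow> ('i \<Rightarrow> 'b) residuated_lattice" where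
  "rl_product I F = \<lparr>
     carrier = (\<Pi>\<^sub>E i\<in>I. carrier (F i)),
     mult = (\<lambda>f g. \<lambda>i\<in>I. f i \<otimes>\<^bsub>F i\<^esub> g i),
     one = (\<lambda>i\<in>I. \<one>\<^bsub>F i\<^esub>),
     rl_meet = (\<lambda>f g. \<lambda>i\<in>I. f i \<^bold>\<and>\<^bsub>F i\<^esub> g i),
     rl_join = (\<lambda>f g. \<lambda>i\<in>I. f i \<^bold>\<or>\<^bsub>F i\<^esub> g i),
     lres = (\<lambda>f g. \<lambda>i\<in>I. f i \<setminus>\<^bsub>F i\<^esub> g i),
     rres = (\<lambda>f g. \<lambda>i\<in>I. f i \<^bold>/\<^bsub>F i\<^esub> g i)\<rparr>"

definition subuniverse :: "'a set \<Rightarrow> ('a, 'm) residuated_lattice_scheme \<Rightarrow> bool" where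
  "subuniverse S L \<longleftrightarrow> S \<subseteq> carrier L \<and> \<one>\<^bsub>L\<^esub> \<in> S \<and>
     (\<forall>a\<in>S. \<forall>b\<in>S. a \<otimes>\<^bsub>L\<^esub> b \<in> S \<and> a \<^bold>\<and>\<^bsub>L\<^esub> b \<in> S \<and> a \<^bold>\<or>\<^bsub>L\<^esub> b \<in> S \<and>
        a \<setminus>\<^bsub>L\<^esub> b \<in> S \<and> a \<^bold>/\<^bsub>L\<^esub> b \<in> S)"

definition subdirect :: "('i \<Rightarrow> 'b) set \<Rightarrow> 'i set \<Rightarrow> ('i \<Rightarrow> ('b, 'm) residuated_lattice_scheme)
    \<Rightarrow> bool" where
  "subdirect S I F \<longleftrightarrow> subuniverse S (rl_product I F) \<and> (\<forall>i\<in>I. (\<lambda>f. f i) ` S = carrier (F i))"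

definition subdirect_of_chains :: "('a, 'm) residuated_lattice_scheme \<Rightarrow> 'i set
    \<Rightarrow> ('i \<Rightarrow> ('b, 'n) residuated_lattice_scheme) \<Rightarrow> bool" where
  "subdirect_of_chains L I F \<longleftrightarrow>
     (\<forall>i\<in>I. residuated_lattice (F i) \<and> totally_ordered (F i)) \<and>
     (\<exists>S. subdirect S I F \<and> rl_iso L (rl_product I F\<lparr>carrier := S\<rparr>) \<noteq> {})"

text \<open>An existential quantifier in HOL cannot range over types, so types for the index set and
  for the factors have to be fixed. The types chosen are those of congruences of \<open>L\<close> and of
  congruence classes; the theorem \<open>semilinearI\<close> below shows that this is no restriction.\<close>

definition semilinear :: "('a, 'm) residuated_lattice_scheme \<Rightarrow> bool" where
  "semilinear L \<longleftrightarrow>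
     (\<exists>(I :: ('a \<times> 'a) set set) (F :: ('a \<times> 'a) set \<Rightarrow> 'a set residuated_lattice).
        subdirect_of_chains L I F)"

definition transport :: "('b \<Rightarrow> 'c) \<Rightarrow> ('b, 'm) residuated_lattice_scheme \<Rightarrow> 'c residuated_lattice"
  where "transport f F = (let g = inv_into (carrier F) f in \<lparr>
     carrier = f ` carrier F,
     mult = (\<lambda>a b. f (g a \<otimes>\<^bsub>F\<^esub> g b)),
     one = f \<one>\<^bsub>F\<^esub>,
     rl_meet = (\<lambda>a b. f (g a \<^bold>\<and>\<^bsub>F\<^esub> g b)),
     rl_join = (\<lambda>a b. f (g a \<^bold>\<or>\<^bsub>F\<^esub> g b)),
     lres = (\<lambda>a b. f (g a \<setminus>\<^bsub>F\<^esub> g b)),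
     rres = (\<lambda>a b. f (g a \<^bold>/\<^bsub>F\<^esub> g b))\<rparr>)"

lemma carrier_transport [simp]: "carrier (transport f F) = f ` carrier F"
  by (simp add: transport_def Let_def)

lemma one_transport [simp]: "\<one>\<^bsub>transport f F\<^esub> = f \<one>\<^bsub>F\<^esub>"
  by (simp add: transport_def Let_def)

lemma transport_ops:
  assumes "inj_on f (carrier F)" "a \<in> carrier F" "b \<in> carrier F"
  shows "f a \<otimes>\<^bsub>transport f F\<^esub> f b = f (a \<otimes>\<^bsub>F\<^esub> b)"
    and "f a \<^bold>\<and>\<^bsub>transport f F\<^esub> f b = f (a \<^bold>\<and>\<^bsub>F\<^esub> b)"
    and "f a \<^bold>\<or>\<^bsub>transport f F\<^esub> f b = f (a \<^bold>\<or>\<^bsub>F\<^esub> b)"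
    and "f a \<setminus>\<^bsub>transport f F\<^esub> f b = f (a \<setminus>\<^bsub>F\<^esub> b)"
    and "f a \<^bold>/\<^bsub>transport f F\<^esub> f b = f (a \<^bold>/\<^bsub>F\<^esub> b)"
  using assms by (simp_all add: transport_def Let_def inv_into_f_f)

lemma transport_le:
  assumes "residuated_lattice F" "inj_on f (carrier F)" "a \<in> carrier F" "b \<in> carrier F"
  shows "f a \<preceq>\<^bsub>transport f F\<^esub> f b \<longleftrightarrow> a \<preceq>\<^bsub>F\<^esub> b"
  using assms residuated_lattice.meet_closed[OF assms(1)]
  by (auto simp: rl_le_def transport_ops inj_on_eq_iff)

lemma transport_residuated_lattice:
  assumes F: "residuated_lattice F" and f: "inj_on f (carrier F)"
  shows "residuated_lattice (transport f F)"
proof -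
  interpret F: residuated_lattice F by fact
  note [simp] = F.meet_closed F.join_closed F.lres_closed F.rres_closed transport_ops[OF f]
    F.m_assoc F.meet_assoc F.join_assoc F.meet_absorb F.join_absorb transport_le[OF F f]
  show ?thesis
  proof (unfold_locales, goal_cases)
    case (9 x y) then show ?case by auto
  qed (auto intro!: arg_cong[where f = f] F.meet_comm F.join_comm
      simp: F.rres_adjoint[symmetric] F.lres_adjoint[symmetric])
qed

lemma transport_totally_ordered:
  assumes "residuated_lattice F" "inj_on f (carrier F)" "totally_ordered F"
  shows "totally_ordered (transport f F)"
  using assms by (auto simp: totally_ordered_def transport_le)

theorem semilinearI:
  fixes L :: "('a, 'm) residuated_lattice_scheme" and I :: "'i set"
    and F :: "'i \<Rightarrow> ('b, 'n) residuated_lattice_scheme"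
  assumes L: "residuated_lattice L" and chains: "subdirect_of_chains L I F"
  shows "semilinear L"
proof -
  interpret L: residuated_lattice L by fact
  note [simp] = L.meet_closed L.join_closed L.lres_closed L.rres_closed
  obtain S h where F: "\<And>i. i \<in> I \<Longrightarrow> residuated_lattice (F i)"
    and F_tot: "\<And>i. i \<in> I \<Longrightarrow> totally_ordered (F i)"
    and S: "subdirect S I F" and h: "h \<in> rl_iso L (rl_product I F\<lparr>carrier := S\<rparr>)"
    using chains by (auto simp: subdirect_of_chains_def)
  have h_bij: "bij_betw h (carrier L) S"
    using h by (simp add: rl_iso_def)
  have S_prod: "S \<subseteq> (\<Pi>\<^sub>E i\<in>I. carrier (F i))"
    using S by (simp add: subdirect_def subuniverse_def rl_product_def)
  have proj_onto: "(\<lambda>x. h x i) ` carrier L = carrier (F i)" if "i \<in> I" for i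
  proof -
    have "(\<lambda>f. f i) ` S = carrier (F i)" using S that by (simp add: subdirect_def)
    moreover have "S = h ` carrier L" using h_bij by (simp add: bij_betw_def)
    ultimately show ?thesis by (simp add: image_image)
  qed
  have h_one: "h \<one>\<^bsub>L\<^esub> i = \<one>\<^bsub>F i\<^esub>" if "i \<in> I" for i
    using h that by (simp add: rl_iso_def rl_product_def)
  have h_ops: "h (a \<otimes>\<^bsub>L\<^esub> b) i = h a i \<otimes>\<^bsub>F i\<^esub> h b i"
    "h (a \<^bold>\<and>\<^bsub>L\<^esub> b) i = h a i \<^bold>\<and>\<^bsub>F i\<^esub> h b i"
    "h (a \<^bold>\<or>\<^bsub>L\<^esub> b) i = h a i \<^bold>\<or>\<^bsub>F i\<^esub> h b i"
    "h (a \<setminus>\<^bsub>L\<^esub> b) i = h a i \<setminus>\<^bsub>F i\<^esub> h b i"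
    "h (a \<^bold>/\<^bsub>L\<^esub> b) i = h a i \<^bold>/\<^bsub>F i\<^esub> h b i"
    if "i \<in> I" "a \<in> carrier L" "b \<in> carrier L" for i a b
    using h that by (simp_all add: rl_iso_def rl_product_def)

  define k where "k i = {(x, y). x \<in> carrier L \<and> y \<in> carrier L \<and> h x i = h y i}" for i
  define J where "J = k ` I"
  define r where "r = inv_into I k"
  define c where "c j u = {x \<in> carrier L. h x (r j) = u}" for j u
  define G where "G j = transport (c j) (F (r j))" for j
  define h' where "h' x = (\<lambda>j\<in>J. c j (h x (r j)))" for x
  have r: "r j \<in> I" "k (r j) = j" if "j \<in> J" for j
    using that by (simp_all add: J_def r_def inv_into_into f_inv_into_f)
  have c_inj: "inj_on (c j) (carrier (F (r j)))" if j: "j \<in> J" for j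
  proof (rule inj_onI)
    fix u v assume uv: "u \<in> carrier (F (r j))" "v \<in> carrier (F (r j))" "c j u = c j v"
    obtain x where "x \<in> carrier L" "h x (r j) = u"
      using proj_onto[OF r(1)[OF j]] uv(1) by (metis imageE)
    then have "x \<in> c j v" using uv(3) by (auto simp: c_def)
    then show "u = v" using \<open>h x (r j) = u\<close> by (simp add: c_def)
  qed
  have h_closed: "h x (r j) \<in> carrier (F (r j))" if "j \<in> J" "x \<in> carrier L" for j x
    using proj_onto[OF r(1)[OF that(1)]] that(2) by auto
  have G_chain: "residuated_lattice (G j)" "totally_ordered (G j)" if "j \<in> J" for j
    unfolding G_def
    using transport_residuated_lattice[OF F c_inj] transport_totally_ordered[OF F c_inj F_tot] r that
    by simp_all

  have h'_closed: "h' x \<in> carrier (rl_product J G)" if "x \<in> carrier L" for x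
    using that h_closed by (auto simp: h'_def rl_product_def G_def)
  have h'_one: "h' \<one>\<^bsub>L\<^esub> = \<one>\<^bsub>rl_product J G\<^esub>"
    by (auto simp: h'_def rl_product_def G_def h_one r intro!: restrict_ext)
  have h'_ops: "h' (a \<otimes>\<^bsub>L\<^esub> b) = h' a \<otimes>\<^bsub>rl_product J G\<^esub> h' b"
    "h' (a \<^bold>\<and>\<^bsub>L\<^esub> b) = h' a \<^bold>\<and>\<^bsub>rl_product J G\<^esub> h' b"
    "h' (a \<^bold>\<or>\<^bsub>L\<^esub> b) = h' a \<^bold>\<or>\<^bsub>rl_product J G\<^esub> h' b"
    "h' (a \<setminus>\<^bsub>L\<^esub> b) = h' a \<setminus>\<^bsub>rl_product J G\<^esub> h' b"
    "h' (a \<^bold>/\<^bsub>L\<^esub> b) = h' a \<^bold>/\<^bsub>rl_product J G\<^esub> h' b"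
    if "a \<in> carrier L" "b \<in> carrier L" for a b
    using that
    by (simp_all add: h'_def rl_product_def G_def fun_eq_iff restrict_def h_ops r
        transport_ops c_inj h_closed)
  have h'_inj: "inj_on h' (carrier L)"
  proof (rule inj_onI)
    fix x y assume xy: "x \<in> carrier L" "y \<in> carrier L" "h' x = h' y"
    have "h x i = h y i" if i: "i \<in> I" for i
    proof -
      have j: "k i \<in> J" using i by (simp add: J_def)
      have "c (k i) (h x (r (k i))) = c (k i) (h y (r (k i)))"
        using fun_cong[OF xy(3), of "k i"] j by (simp add: h'_def)
      then have "h x (r (k i)) = h y (r (k i))"
        using inj_onD[OF c_inj[OF j]] h_closed[OF j] xy by blast
      then have "(x, y) \<in> k (r (k i))" using xy by (simp add: k_def)
      then have "(x, y) \<in> k i" by (simp only: r(2)[OF j])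
      then show ?thesis by (simp add: k_def)
    qed
    moreover have "h x \<in> S" "h y \<in> S" using h_bij xy by (auto simp: bij_betw_def)
    ultimately have "h x = h y"
      using S_prod by (intro PiE_ext[of "h x" I "\<lambda>i. carrier (F i)" "h y"]) auto
    then show "x = y" using h_bij xy by (auto simp: bij_betw_def dest: inj_onD)
  qed
  have sub: "subuniverse (h' ` carrier L) (rl_product J G)"
    unfolding subuniverse_def
    using h'_closed by (auto simp: h'_one[symmetric] h'_ops[symmetric])
  moreover have "(\<lambda>f. f j) ` h' ` carrier L = carrier (G j)" if "j \<in> J" for j
  proof -
    have "(\<lambda>f. f j) ` h' ` carrier L = c j ` (\<lambda>x. h x (r j)) ` carrier L"
      using that by (simp add: image_image h'_def)
    then show ?thesis by (simp add: proj_onto r that G_def)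
  qed
  ultimately have "subdirect (h' ` carrier L) J G" by (simp add: subdirect_def)
  moreover have "h' \<in> rl_iso L (rl_product J G\<lparr>carrier := h' ` carrier L\<rparr>)"
    using h'_inj by (simp add: rl_iso_def bij_betw_def h'_one h'_ops)
  ultimately have "subdirect_of_chains L J G"
    using G_chain by (auto simp: subdirect_of_chains_def)
  then show ?thesis by (auto simp: semilinear_def)
qed

end

theory Submission
  imports Defs
begin

text \<open>Write \<open>e\<close> for the unit and call \<open>x\<close>, \<open>y\<close> orthogonal if \<open>x \<or> y = e\<close>. The chains are quotients
  \<open>L/H\<close>, where \<open>H\<close> is a filter of the negative cone \<open>{a. a \<le> e}\<close> that is closed under multiplication
  and contains one of \<open>x\<close>, \<open>y\<close> whenever they are orthogonal. Put \<open>a \<le>\<^sub>H b\<close> if \<open>a h \<le> b\<close> for some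
  \<open>h \<in> H\<close>. Prelinearity makes this preorder total. Every maximal lattice ideal \<open>D\<close> of the cone
  yields such an \<open>H\<close>, namely the set of all elements orthogonal to a member of \<open>D\<close>, and this \<open>H\<close> is
  disjoint from \<open>D\<close>. Since \<open>a \<le>\<^sub>H b\<close> means \<open>(a \ b) \<and> e \<in> H\<close> and each element of the cone other
  than \<open>e\<close> lies in a maximal ideal, these preorders together separate the elements of \<open>L\<close>. They are
  invariant under left multiplication, but \<open>\<le>\<^sub>H\<close> defines a congruence only if \<open>H\<close> is normal: for
  \<open>h \<in> H\<close> and \<open>u \<in> L\<close> there must be \<open>s, t \<in> H\<close> with \<open>u s \<le> h u\<close> and \<open>t u \<le> u h\<close>.

  Normality follows from the claim that orthogonality survives conjugation: if \<open>x \<or> y = e\<close> then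
  \<open>u x \<or> y u = u\<close> (lemma \<open>orth_conj\<close>). This is where nilpotency enters. A nilpotent law provides
  common left multiples, so \<open>L\<close> has a group of left fractions \<open>G\<close>, and all iterated commutators
  \<open>[g, u, ..., u]\<close> of a fixed length are trivial in \<open>G\<close> (lemma \<open>fractions_engel\<close>). The preorder
  \<open>\<le>\<^sub>H\<close> extends to a total left-invariant preorder of \<open>G\<close>. Consider the sequence
  \<open>g\<^sub>k = u\<^sup>-\<^sup>k g u\<^sup>k\<close>. Because \<open>g\<^sub>k\<^sup>-\<^sup>1 g\<^sub>k\<^sub>+\<^sub>1\<close> is the same sequence for the commutator
  \<open>[g, u]\<close>, it behaves like a polynomial in \<open>k\<close> with \<open>[g, u]\<close> as its difference. In particular its
  sign is eventually constant, it is eventually monotone, and if it is eventually equivalent to \<open>e\<close>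
  then it is so for all \<open>k\<close>. Hence if all \<open>g\<^sub>k\<close> are below \<open>e\<close> and infinitely many of them are
  equivalent to \<open>e\<close>, then all of them are (lemma \<open>engel_conj_seq_trivial\<close>). Now let \<open>x\<close>, \<open>y\<close>
  be orthogonal. For each \<open>k\<close> one of \<open>x\<^sub>k\<close>, \<open>y\<^sub>k\<close> is equivalent to \<open>e\<close>, so one of the two sequences
  has this property infinitely often and therefore always. So \<open>x\<^sub>0\<close> or \<open>y\<^sub>1\<close> is equivalent to \<open>e\<close>,
  for every \<open>H\<close>, and the claim follows by separation.\<close>

section \<open>Order and multiplication in a residuated lattice\<close>

context residuated_lattice
begin

lemmas rl_closed [simp, intro] = meet_closed join_closed lres_closed rres_closed

lemma le_refl [simp]: "a \<in> carrier L \<Longrightarrow> a \<preceq> a"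
  by (metis rl_le_def join_absorb meet_absorb meet_closed)

lemma le_antisym: "\<lbrakk>a \<preceq> b; b \<preceq> a; a \<in> carrier L; b \<in> carrier L\<rbrakk> \<Longrightarrow> a = b"
  by (metis rl_le_def meet_comm)

lemma le_trans [trans]:
  "\<lbrakk>a \<preceq> b; b \<preceq> d; a \<in> carrier L; b \<in> carrier L; d \<in> carrier L\<rbrakk> \<Longrightarrow> a \<preceq> d"
  by (metis rl_le_def meet_assoc)

lemma le_join_iff: "\<lbrakk>a \<in> carrier L; b \<in> carrier L\<rbrakk> \<Longrightarrow> a \<preceq> b \<longleftrightarrow> a \<^bold>\<or> b = b"
  by (metis rl_le_def join_absorb join_comm meet_absorb meet_comm)

lemma meet_le [simp]:
  assumes "a \<in> carrier L" "b \<in> carrier L"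
  shows "a \<^bold>\<and> b \<preceq> a" "a \<^bold>\<and> b \<preceq> b"
  using assms by (metis rl_le_def le_refl meet_assoc meet_comm)+

lemma le_meet_iff:
  "\<lbrakk>a \<in> carrier L; b \<in> carrier L; d \<in> carrier L\<rbrakk> \<Longrightarrow> d \<preceq> a \<^bold>\<and> b \<longleftrightarrow> d \<preceq> a \<and> d \<preceq> b"
  by (metis rl_le_def le_trans meet_assoc meet_closed meet_le)

lemma join_ge [simp]:
  assumes "a \<in> carrier L" "b \<in> carrier L"
  shows "a \<preceq> a \<^bold>\<or> b" "b \<preceq> a \<^bold>\<or> b"
  using assms by (metis rl_le_def join_comm meet_absorb)+

lemma join_le_iff:
  assumes "a \<in> carrier L" "b \<in> carrier L" "d \<in> carrier L"
  shows "a \<^bold>\<or> b \<preceq> d \<longleftrightarrow> a \<preceq> d \<and> b \<preceq> d"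
  using assms by (metis join_assoc join_closed join_ge le_join_iff le_trans)

lemma mult_left_mono:
  "\<lbrakk>a \<preceq> b; a \<in> carrier L; b \<in> carrier L; d \<in> carrier L\<rbrakk> \<Longrightarrow> d \<otimes> a \<preceq> d \<otimes> b"
  by (meson lres_adjoint le_refl le_trans lres_closed m_closed)

lemma mult_right_mono:
  "\<lbrakk>a \<preceq> b; a \<in> carrier L; b \<in> carrier L; d \<in> carrier L\<rbrakk> \<Longrightarrow> a \<otimes> d \<preceq> b \<otimes> d"
  by (meson rres_adjoint le_refl le_trans rres_closed m_closed)

lemma mult_join_le_iff:
  assumes "a \<in> carrier L" "b \<in> carrier L" "d \<in> carrier L" "w \<in> carrier L"
  shows "w \<otimes> (a \<^bold>\<or> b) \<preceq> d \<longleftrightarrow> w \<otimes> a \<preceq> d \<and> w \<otimes> b \<preceq> d"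
    and "(a \<^bold>\<or> b) \<otimes> w \<preceq> d \<longleftrightarrow> a \<otimes> w \<preceq> d \<and> b \<otimes> w \<preceq> d"
  using assms by (simp add: lres_adjoint join_le_iff, simp add: rres_adjoint join_le_iff)

lemma mult_join_distrib:
  assumes "a \<in> carrier L" "b \<in> carrier L" "w \<in> carrier L"
  shows "w \<otimes> (a \<^bold>\<or> b) = w \<otimes> a \<^bold>\<or> w \<otimes> b"
    and "(a \<^bold>\<or> b) \<otimes> w = a \<otimes> w \<^bold>\<or> b \<otimes> w"
  using assms
  by (auto intro!: le_antisym simp: mult_join_le_iff join_le_iff mult_left_mono mult_right_mono)

lemma mult_le_left: "\<lbrakk>h \<preceq> \<one>; h \<in> carrier L; a \<in> carrier L\<rbrakk> \<Longrightarrow> a \<otimes> h \<preceq> a"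
  using mult_left_mono[of h \<one> a] by simp

lemma mult_le_right: "\<lbrakk>h \<preceq> \<one>; h \<in> carrier L; a \<in> carrier L\<rbrakk> \<Longrightarrow> h \<otimes> a \<preceq> a"
  using mult_right_mono[of h \<one> a] by simp

lemma lres_mult_le: "\<lbrakk>a \<in> carrier L; b \<in> carrier L\<rbrakk> \<Longrightarrow> a \<otimes> (a \<setminus> b) \<preceq> b"
  by (simp add: lres_adjoint)

lemma rres_mult_le: "\<lbrakk>a \<in> carrier L; b \<in> carrier L\<rbrakk> \<Longrightarrow> (b \<^bold>/ a) \<otimes> a \<preceq> b"
  by (simp add: rres_adjoint)

end

section \<open>Groups of fractions\<close>

text \<open>The classical construction for a cancellative monoid in which any two elements have a common
  left multiple; \<open>frac a b\<close> stands for \<open>a\<^sup>-\<^sup>1 b\<close>.\<close>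

locale ore_monoid = monoid_cancel M for M (structure) +
  assumes ore: "\<lbrakk>a \<in> carrier M; b \<in> carrier M\<rbrakk>
    \<Longrightarrow> \<exists>s\<in>carrier M. \<exists>t\<in>carrier M. s \<otimes> a = t \<otimes> b"
begin

text \<open>The fractions \<open>a\<^sup>-\<^sup>1 b\<close> and \<open>c\<^sup>-\<^sup>1 d\<close> agree if they can be expanded to the same pair.\<close>

definition same_frac :: "'a \<Rightarrow> 'a \<Rightarrow> 'a \<Rightarrow> 'a \<Rightarrow> bool" where
  "same_frac a b c d \<longleftrightarrow> (\<exists>s\<in>carrier M. \<exists>t\<in>carrier M. s \<otimes> a = t \<otimes> c \<and> s \<otimes> b = t \<otimes> d)"

definition frac :: "'a \<Rightarrow> 'a \<Rightarrow> ('a \<times> 'a) set" where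
  "frac a b = {(c, d). c \<in> carrier M \<and> d \<in> carrier M \<and> same_frac a b c d}"

text \<open>Two fractions are multiplied by expanding them to the form \<open>a\<^sup>-\<^sup>1 b\<close> and \<open>b\<^sup>-\<^sup>1 d\<close>, with product
  \<open>a\<^sup>-\<^sup>1 d\<close>. All such expansions give the same product, so the union is over a single set.\<close>

definition fractions :: "('a \<times> 'a) set monoid" where
  "fractions = \<lparr>
     carrier = {frac a b | a b. a \<in> carrier M \<and> b \<in> carrier M},
     mult = (\<lambda>X Y. \<Union>{frac a d | a b d. (a, b) \<in> X \<and> (b, d) \<in> Y}),
     one = frac \<one> \<one>\<rparr>"

lemma same_frac_refl: "same_frac a b a b"
  unfolding same_frac_def using one_closed by blast

lemma same_frac_sym: "same_frac a b c d \<Longrightarrow> same_frac c d a b"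
  unfolding same_frac_def by metis

lemma same_frac_trans:
  assumes "same_frac a b c d" "same_frac c d e f"
    and [simp]: "a \<in> carrier M" "b \<in> carrier M" "c \<in> carrier M" "d \<in> carrier M"
      "e \<in> carrier M" "f \<in> carrier M"
  shows "same_frac a b e f"
proof -
  obtain s t where [simp]: "s \<in> carrier M" "t \<in> carrier M"
    and st: "s \<otimes> a = t \<otimes> c" "s \<otimes> b = t \<otimes> d"
    using assms(1) by (auto simp: same_frac_def)
  obtain s' t' where [simp]: "s' \<in> carrier M" "t' \<in> carrier M"
    and st': "s' \<otimes> c = t' \<otimes> e" "s' \<otimes> d = t' \<otimes> f"
    using assms(2) by (auto simp: same_frac_def)
  obtain m n where [simp]: "m \<in> carrier M" "n \<in> carrier M" and mn: "m \<otimes> t = n \<otimes> s'"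
    using ore[of t s'] by auto
  have chain: "m \<otimes> s \<otimes> p = n \<otimes> t' \<otimes> r"
    if "s \<otimes> p = t \<otimes> q" "s' \<otimes> q = t' \<otimes> r"
      and [simp]: "p \<in> carrier M" "q \<in> carrier M" "r \<in> carrier M" for p q r
  proof -
    have "m \<otimes> s \<otimes> p = m \<otimes> t \<otimes> q" by (simp add: m_assoc that(1))
    also have "\<dots> = n \<otimes> t' \<otimes> r" by (simp only: mn) (simp add: m_assoc that(2))
    finally show ?thesis .
  qed
  have "m \<otimes> s \<otimes> a = n \<otimes> t' \<otimes> e" "m \<otimes> s \<otimes> b = n \<otimes> t' \<otimes> f"
    using chain[OF st(1) st'(1)] chain[OF st(2) st'(2)] by simp_all
  then show ?thesis unfolding same_frac_def by (meson \<open>m \<in> _\<close> \<open>n \<in> _\<close> \<open>s \<in> _\<close> \<open>t' \<in> _\<close> m_closed)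
qed

lemma same_frac_scale:
  "\<lbrakk>a \<in> carrier M; b \<in> carrier M; s \<in> carrier M\<rbrakk> \<Longrightarrow> same_frac a b (s \<otimes> a) (s \<otimes> b)"
  unfolding same_frac_def by (metis l_one m_closed one_closed)

lemma frac_eq_iff:
  assumes "a \<in> carrier M" "b \<in> carrier M" "c \<in> carrier M" "d \<in> carrier M"
  shows "frac a b = frac c d \<longleftrightarrow> same_frac a b c d"
proof
  assume "frac a b = frac c d"
  then have "(c, d) \<in> frac a b" using assms by (simp add: frac_def same_frac_refl)
  then show "same_frac a b c d" by (simp add: frac_def)
next
  assume "same_frac a b c d"
  then show "frac a b = frac c d"
    using assms by (auto simp: frac_def) (meson same_frac_trans same_frac_sym)+
qed

lemma frac_scale:
  "\<lbrakk>a \<in> carrier M; b \<in> carrier M; s \<in> carrier M\<rbrakk> \<Longrightarrow> frac (s \<otimes> a) (s \<otimes> b) = frac a b"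
  by (metis same_frac_scale frac_eq_iff m_closed)

lemma frac_closed [simp]: "\<lbrakk>a \<in> carrier M; b \<in> carrier M\<rbrakk> \<Longrightarrow> frac a b \<in> carrier fractions"
  by (auto simp: fractions_def)

lemma fractions_cases:
  assumes "X \<in> carrier fractions"
  obtains a b where "a \<in> carrier M" "b \<in> carrier M" "X = frac a b"
  using assms by (auto simp: fractions_def)

text \<open>The two expansions of the middle entry are compared by means of a further common multiple;
  right cancellation of \<open>b'\<close> then shows that both pairs are expanded by the same factors.\<close>

lemma frac_mult:
  assumes [simp]: "a \<in> carrier M" "b \<in> carrier M" "d \<in> carrier M"
  shows "frac a b \<otimes>\<^bsub>fractions\<^esub> frac b d = frac a d"
proof -
  have "frac a' d' = frac a d" if "(a', b') \<in> frac a b" "(b', d') \<in> frac b d" for a' b' d'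
  proof -
    have [simp]: "a' \<in> carrier M" "b' \<in> carrier M" "d' \<in> carrier M"
      using that by (auto simp: frac_def)
    have ab': "same_frac a b a' b'" and bd': "same_frac b d b' d'"
      using that by (simp_all add: frac_def)
    obtain s t where [simp]: "s \<in> carrier M" "t \<in> carrier M"
      and st: "s \<otimes> a = t \<otimes> a'" "s \<otimes> b = t \<otimes> b'"
      using ab' unfolding same_frac_def by blast
    obtain p q where [simp]: "p \<in> carrier M" "q \<in> carrier M"
      and pq: "p \<otimes> b = q \<otimes> b'" "p \<otimes> d = q \<otimes> d'"
      using bd' unfolding same_frac_def by blast
    obtain m n where [simp]: "m \<in> carrier M" "n \<in> carrier M" and mn: "m \<otimes> s = n \<otimes> p"
      using ore[of s p] by auto
    have "m \<otimes> t \<otimes> b' = m \<otimes> s \<otimes> b" using st by (simp add: m_assoc)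
    also have "\<dots> = n \<otimes> q \<otimes> b'" using pq by (simp add: m_assoc mn)
    finally have mtnq: "m \<otimes> t = n \<otimes> q" by (simp add: r_cancel)
    have "m \<otimes> s \<otimes> a = m \<otimes> t \<otimes> a'" using st by (simp add: m_assoc)
    moreover have "m \<otimes> s \<otimes> d = m \<otimes> t \<otimes> d'" using pq by (simp add: m_assoc mn mtnq)
    ultimately have "same_frac a d a' d'"
      unfolding same_frac_def
      by (intro bexI[of _ "m \<otimes> s"] bexI[of _ "m \<otimes> t"]) auto
    then show ?thesis by (simp add: frac_eq_iff same_frac_sym)
  qed
  moreover have "(a, b) \<in> frac a b" "(b, d) \<in> frac b d" by (simp_all add: frac_def same_frac_refl)
  ultimately have "{frac x z | x y z. (x, y) \<in> frac a b \<and> (y, z) \<in> frac b d} = {frac a d}"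
    by blast
  then show ?thesis by (simp add: fractions_def)
qed

lemma fractions_common:
  assumes "X \<in> carrier fractions" "Y \<in> carrier fractions"
  obtains a b d where "a \<in> carrier M" "b \<in> carrier M" "d \<in> carrier M"
    "X = frac a b" "Y = frac b d"
proof -
  obtain a b where ab: "a \<in> carrier M" "b \<in> carrier M" "X = frac a b"
    using assms(1) by (rule fractions_cases)
  obtain c d where cd: "c \<in> carrier M" "d \<in> carrier M" "Y = frac c d"
    using assms(2) by (rule fractions_cases)
  obtain s t where st: "s \<in> carrier M" "t \<in> carrier M" "s \<otimes> b = t \<otimes> c"
    using ore ab cd by blast
  show ?thesis
  proof (rule that[of "s \<otimes> a" "s \<otimes> b" "t \<otimes> d"])
    show "X = frac (s \<otimes> a) (s \<otimes> b)" using ab st(1) by (simp add: frac_scale)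
    show "Y = frac (s \<otimes> b) (t \<otimes> d)" using cd st(2) by (simp add: st(3) frac_scale)
  qed (use ab cd st in auto)
qed

lemma fractions_one: "a \<in> carrier M \<Longrightarrow> \<one>\<^bsub>fractions\<^esub> = frac a a"
  using frac_scale[of \<one> \<one> a] by (simp add: fractions_def)

lemma group_fractions: "group fractions"
proof (rule groupI)
  fix X Y assume "X \<in> carrier fractions" "Y \<in> carrier fractions"
  then show "X \<otimes>\<^bsub>fractions\<^esub> Y \<in> carrier fractions"
    by (rule fractions_common) (simp add: frac_mult)
next
  show "\<one>\<^bsub>fractions\<^esub> \<in> carrier fractions" by (simp add: fractions_one[of \<one>])
next
  fix X Y Z
  assume X: "X \<in> carrier fractions" and Y: "Y \<in> carrier fractions" and Z: "Z \<in> carrier fractions"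
  obtain a b d where abd: "a \<in> carrier M" "b \<in> carrier M" "d \<in> carrier M"
      "X = frac a b" "Y = frac b d"
    using X Y by (rule fractions_common)
  obtain d' e where de: "d' \<in> carrier M" "e \<in> carrier M" "Z = frac d' e"
    using Z by (rule fractions_cases)
  obtain s t where st: "s \<in> carrier M" "t \<in> carrier M" "s \<otimes> d = t \<otimes> d'"
    using ore abd de by blast
  have "X = frac (s \<otimes> a) (s \<otimes> b)" "Y = frac (s \<otimes> b) (s \<otimes> d)" "Z = frac (s \<otimes> d) (t \<otimes> e)"
    using abd de st(1,2) by (simp_all add: frac_scale) (simp add: st(3) frac_scale)
  then show "X \<otimes>\<^bsub>fractions\<^esub> Y \<otimes>\<^bsub>fractions\<^esub> Z = X \<otimes>\<^bsub>fractions\<^esub> (Y \<otimes>\<^bsub>fractions\<^esub> Z)"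
    using abd(1-3) de(1,2) st(1,2) by (simp add: frac_mult)
next
  fix X assume "X \<in> carrier fractions"
  then obtain a b where ab: "a \<in> carrier M" "b \<in> carrier M" "X = frac a b"
    by (rule fractions_cases)
  then show "\<one>\<^bsub>fractions\<^esub> \<otimes>\<^bsub>fractions\<^esub> X = X"
    by (simp add: fractions_one[of a] frac_mult)
  have "frac b a \<otimes>\<^bsub>fractions\<^esub> X = \<one>\<^bsub>fractions\<^esub>"
    unfolding ab(3) fractions_one[OF ab(2)] by (rule frac_mult[OF ab(2,1,2)])
  then show "\<exists>Y\<in>carrier fractions. Y \<otimes>\<^bsub>fractions\<^esub> X = \<one>\<^bsub>fractions\<^esub>"
    using ab(1,2) frac_closed by blast
qed

lemma inv_frac:
  assumes "a \<in> carrier M" "b \<in> carrier M"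
  shows "inv\<^bsub>fractions\<^esub> (frac a b) = frac b a"
proof -
  interpret F: group fractions by (rule group_fractions)
  show ?thesis
    using assms by (intro F.inv_equality) (simp_all add: frac_mult fractions_one[of b])
qed

lemma frac_one_mult:
  assumes "a \<in> carrier M" "b \<in> carrier M"
  shows "frac \<one> a \<otimes>\<^bsub>fractions\<^esub> frac \<one> b = frac \<one> (a \<otimes> b)"
  using assms frac_scale[of \<one> b a] frac_mult[of \<one> a "a \<otimes> b"] by simp

lemma frac_decompose:
  assumes "a \<in> carrier M" "b \<in> carrier M"
  shows "frac a b = inv\<^bsub>fractions\<^esub> (frac \<one> a) \<otimes>\<^bsub>fractions\<^esub> frac \<one> b"
  using assms by (simp add: inv_frac frac_mult)

lemma qterm_frac:
  assumes "x \<in> carrier M" "y \<in> carrier M" "\<And>i. z i \<in> carrier M" "c \<ge> 1"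
  shows "qterm M c x y z \<in> carrier M \<and>
    qterm fractions c (frac \<one> x) (frac \<one> y) (\<lambda>i. frac \<one> (z i)) = frac \<one> (qterm M c x y z)"
  using assms(4,1-3)
  by (induction c arbitrary: x y rule: nat_induct_at_least) 
     (auto simp: frac_one_mult numeral_eq_Suc Suc_le_eq gr0_conv_Suc)

end

section \<open>Nilpotent laws in groups\<close>

context group
begin

lemma inv_cancel [simp]:
  assumes "a \<in> carrier G" "b \<in> carrier G"
  shows "inv a \<otimes> (a \<otimes> b) = b" "a \<otimes> (inv a \<otimes> b) = b"
  using assms by (simp_all flip: m_assoc)

text \<open>This is the commutator \<open>[g, u]\<close>. The acting element comes first, so that \<open>(comm u ^^ n) g\<close> is
  the Engel commutator \<open>[g, u, ..., u]\<close>.\<close>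

definition comm :: "'a \<Rightarrow> 'a \<Rightarrow> 'a" where
  "comm u g = inv g \<otimes> (inv u \<otimes> g \<otimes> u)"

lemma comm_closed [simp]: "\<lbrakk>u \<in> carrier G; g \<in> carrier G\<rbrakk> \<Longrightarrow> comm u g \<in> carrier G"
  by (simp add: comm_def)

lemma comm_iter_closed [simp]:
  "\<lbrakk>u \<in> carrier G; g \<in> carrier G\<rbrakk> \<Longrightarrow> (comm u ^^ n) g \<in> carrier G"
  by (induction n) simp_all

lemma comm_swap: "\<lbrakk>u \<in> carrier G; g \<in> carrier G\<rbrakk> \<Longrightarrow> inv (comm u g) = comm g u"
  by (simp add: comm_def inv_mult_group m_assoc)

lemma normal_conj_iff:
  assumes "N \<lhd> G" "g \<in> carrier G" "h \<in> carrier G"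
  shows "inv g \<otimes> h \<otimes> g \<in> N \<longleftrightarrow> h \<in> N"
proof
  assume "inv g \<otimes> h \<otimes> g \<in> N"
  from normal.inv_op_closed2[OF assms(1,2) this] show "h \<in> N"
    using assms(2,3) by (simp add: m_assoc)
qed (rule normal.inv_op_closed1[OF assms(1,2)])

lemma subgroup_comm_mod:
  assumes N: "N \<lhd> G" and r: "r \<in> carrier G"
  shows "subgroup {z \<in> carrier G. comm z r \<in> N} G"
proof -
  interpret N: normal N G by (rule N)
  show ?thesis
  proof (rule subgroupI)
    have "comm \<one> r = \<one>" using r by (simp add: comm_def)
    then show "{z \<in> carrier G. comm z r \<in> N} \<noteq> {}" by (auto intro: exI[of _ \<one>])
  next
    fix z assume z: "z \<in> {z \<in> carrier G. comm z r \<in> N}"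
    have "comm (inv z) r = z \<otimes> inv (comm z r) \<otimes> inv z"
      using z r by (simp add: comm_def inv_mult_group m_assoc)
    then show "inv z \<in> {z \<in> carrier G. comm z r \<in> N}"
      using z N.inv_op_closed2[of z "inv (comm z r)"] by simp
  next
    fix z w assume zw: "z \<in> {z \<in> carrier G. comm z r \<in> N}" "w \<in> {z \<in> carrier G. comm z r \<in> N}"
    have "comm (z \<otimes> w) r = comm w r \<otimes> (inv w \<otimes> comm z r \<otimes> w)"
      using zw r by (simp add: comm_def inv_mult_group m_assoc)
    then show "z \<otimes> w \<in> {z \<in> carrier G. comm z r \<in> N}"
      using zw N.inv_op_closed1[of w "comm z r"] by simp
  qed auto
qed

text \<open>The preimage in \<open>G\<close> of the center of \<open>G/N\<close>.\<close>

definition center_mod :: "'a set \<Rightarrow> 'a set" where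
  "center_mod N = {g \<in> carrier G. \<forall>h\<in>carrier G. comm h g \<in> N}"

lemma normal_center_mod:
  assumes N: "N \<lhd> G"
  shows "center_mod N \<lhd> G"
proof -
  interpret N: normal N G by (rule N)
  have swap: "comm h g \<in> N \<longleftrightarrow> comm g h \<in> N" if "g \<in> carrier G" "h \<in> carrier G" for g h
    using that comm_swap N.m_inv_closed by metis
  have "subgroup {g \<in> carrier G. comm g h \<in> N} G" if "h \<in> carrier G" for h
    by (rule subgroup_comm_mod[OF N that])
  then have "subgroup (\<Inter>((\<lambda>h. {g \<in> carrier G. comm g h \<in> N}) ` carrier G)) G"
    by (intro subgroups_Inter) auto
  moreover have "center_mod N = \<Inter>((\<lambda>h. {g \<in> carrier G. comm g h \<in> N}) ` carrier G)"
    unfolding center_mod_def using swap one_closed by blast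
  ultimately have "subgroup (center_mod N) G" by simp
  moreover have "x \<otimes> g \<otimes> inv x \<in> center_mod N" if "x \<in> carrier G" "g \<in> center_mod N" for x g
  proof -
    have g: "g \<in> carrier G" "\<And>h. h \<in> carrier G \<Longrightarrow> comm h g \<in> N"
      using that by (auto simp: center_mod_def)
    have "comm h (x \<otimes> g \<otimes> inv x) \<in> N" if "h \<in> carrier G" for h
    proof -
      have "comm h (x \<otimes> g \<otimes> inv x) = x \<otimes> comm (inv x \<otimes> h \<otimes> x) g \<otimes> inv x"
        using \<open>x \<in> carrier G\<close> that g(1) by (simp add: comm_def inv_mult_group m_assoc)
      also have "\<dots> \<in> N"
        using \<open>x \<in> carrier G\<close> that g by (intro N.inv_op_closed2) simp_all
      finally show ?thesis .
    qed
    then show ?thesis using that(1) g(1) by (simp add: center_mod_def)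
  qed
  ultimately show ?thesis by (simp add: normal_inv_iff)
qed

lemma qterm_closed:
  "\<lbrakk>c \<ge> 1; x \<in> carrier G; y \<in> carrier G; \<And>i. z i \<in> carrier G\<rbrakk> \<Longrightarrow> qterm G c x y z \<in> carrier G"
proof (induction c arbitrary: x y rule: nat_induct_at_least)
  case (Suc n) then show ?case by (cases n) simp_all
qed simp

lemma qterm_cong:
  assumes "c \<ge> 1" "\<And>i. i < c \<Longrightarrow> z i = z' i"
  shows "qterm G c x y z = qterm G c x y z'"
  using assms
proof (induction c arbitrary: x y rule: nat_induct_at_least)
  case (Suc n)
  then show ?case by (cases n) auto
qed simp

text \<open>The elements that commute with \<open>r\<close> modulo \<open>N\<close> form a subgroup, so it is enough to test a
  set whose left fractions exhaust the group.\<close>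

lemma mem_center_mod_if_generators:
  assumes N: "N \<lhd> G" and r: "r \<in> carrier G"
    and gen: "\<forall>g\<in>carrier G. \<exists>a\<in>S. \<exists>b\<in>S. g = inv a \<otimes> b"
    and S: "S \<subseteq> carrier G" and comm: "\<And>z. z \<in> S \<Longrightarrow> comm z r \<in> N"
  shows "r \<in> center_mod N"
proof -
  let ?K = "{z \<in> carrier G. comm z r \<in> N}"
  have K: "subgroup ?K G" by (rule subgroup_comm_mod[OF N r])
  have "comm g r \<in> N" if g: "g \<in> carrier G" for g
  proof -
    obtain a b where ab: "a \<in> S" "b \<in> S" "g = inv a \<otimes> b" using gen g by meson
    have "a \<in> ?K" "b \<in> ?K" using ab(1,2) S comm by auto
    then have "inv a \<otimes> b \<in> ?K" by (intro subgroup.m_closed[OF K] subgroup.m_inv_closed[OF K])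
    then show ?thesis unfolding ab(3) by simp
  qed
  then show ?thesis using r by (simp add: center_mod_def)
qed

text \<open>This lemma lowers the class. Put \<open>r = B\<^sup>-\<^sup>1 A\<close>. The law says that \<open>w\<^sup>-\<^sup>1 r w\<close> is congruent to
  \<open>A B\<^sup>-\<^sup>1\<close> modulo \<open>N\<close>, which does not depend on \<open>w\<close>; comparing with \<open>w = e\<close> shows that \<open>r\<close> commutes
  with \<open>w\<close> modulo \<open>N\<close>.\<close>

lemma inv_mult_mem_center_mod:
  assumes N: "N \<lhd> G" and AB [simp]: "A \<in> carrier G" "B \<in> carrier G"
    and gen: "\<forall>g\<in>carrier G. \<exists>a\<in>S. \<exists>b\<in>S. g = inv a \<otimes> b"
    and S: "S \<subseteq> carrier G" "\<one> \<in> S"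
    and law: "\<And>w. w \<in> S \<Longrightarrow> inv (B \<otimes> w \<otimes> A) \<otimes> (A \<otimes> w \<otimes> B) \<in> N"
  shows "inv B \<otimes> A \<in> center_mod N"
proof (rule mem_center_mod_if_generators[OF N _ gen S(1)])
  show "inv B \<otimes> A \<in> carrier G" by simp
next
  interpret N: normal N G by (rule N)
  fix w assume w: "w \<in> S"
  then have [simp]: "w \<in> carrier G" using S(1) by blast
  define r where "r = inv B \<otimes> A"
  have [simp]: "r \<in> carrier G" by (simp add: r_def)
  have q: "inv A \<otimes> inv v \<otimes> r \<otimes> v \<otimes> B \<in> N" if v: "v \<in> S" for v
  proof -
    have "v \<in> carrier G" using v S(1) by blast
    then have "inv (B \<otimes> v \<otimes> A) \<otimes> (A \<otimes> v \<otimes> B) = inv A \<otimes> inv v \<otimes> r \<otimes> v \<otimes> B"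
      by (simp add: r_def inv_mult_group m_assoc)
    then show ?thesis using law[OF v] by simp
  qed
  have "(inv A \<otimes> inv w \<otimes> r \<otimes> w \<otimes> B) \<otimes> inv (inv A \<otimes> inv \<one> \<otimes> r \<otimes> \<one> \<otimes> B) \<in> N"
    by (rule N.m_closed[OF q[OF w] N.m_inv_closed[OF q[OF S(2)]]])
  also have "(inv A \<otimes> inv w \<otimes> r \<otimes> w \<otimes> B) \<otimes> inv (inv A \<otimes> inv \<one> \<otimes> r \<otimes> \<one> \<otimes> B)
      = inv A \<otimes> (r \<otimes> comm w r \<otimes> inv r) \<otimes> A"
    by (simp add: comm_def inv_mult_group m_assoc)
  finally have "inv A \<otimes> (r \<otimes> comm w r \<otimes> inv r) \<otimes> A \<in> N" .
  then have "inv (inv r) \<otimes> comm w r \<otimes> inv r \<in> N"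
    using normal_conj_iff[OF N AB(1), of "r \<otimes> comm w r \<otimes> inv r"] by simp
  then have "comm w r \<in> N"
    by (subst (asm) normal_conj_iff[OF N]) simp_all
  then show "comm w (inv B \<otimes> A) \<in> N" by (simp only: r_def)
qed

text \<open>A nilpotent law modulo \<open>N\<close> for the elements of \<open>S\<close> forces the Engel law modulo \<open>N\<close> for the
  whole group. The induction is on the class with \<open>N\<close> arbitrary: the law of the next lower class holds modulo
  the preimage of the center of \<open>G/N\<close>, and one further commutator leads from there into \<open>N\<close>. Working
  modulo normal subgroups instead of in quotients keeps the induction inside a single group.\<close>

theorem engel_of_nilpotent_law:
  assumes S: "S \<subseteq> carrier G" "\<one> \<in> S"
    and gen: "\<forall>g\<in>carrier G. \<exists>a\<in>S. \<exists>b\<in>S. g = inv a \<otimes> b"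
    and "c \<ge> 1" "N \<lhd> G"
    and "\<And>x y z. \<lbrakk>x \<in> S; y \<in> S; \<And>i. z i \<in> S\<rbrakk> \<Longrightarrow> inv (qterm G c y x z) \<otimes> qterm G c x y z \<in> N"
    and u: "u \<in> carrier G" and g: "g \<in> carrier G"
  shows "(comm u ^^ c) g \<in> N"
  using assms(4-6)
proof (induction c arbitrary: N rule: nat_induct_at_least)
  case base
  interpret N: normal N G by (rule base(1))
  have comm_S: "comm x y \<in> N" if xy: "x \<in> S" "y \<in> S" for x y
  proof -
    have xy': "x \<in> carrier G" "y \<in> carrier G" using S(1) xy by blast+
    have "inv (x \<otimes> y) \<otimes> (y \<otimes> x) \<in> N"
      using base(2)[OF xy(2,1), of "\<lambda>_. \<one>"] S(2) by simp
    also have "inv (x \<otimes> y) \<otimes> (y \<otimes> x) = comm x y"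
      using xy' by (simp add: comm_def inv_mult_group m_assoc)
    finally show ?thesis .
  qed
  have "comm y g \<in> N" if y: "y \<in> S" for y
  proof -
    have y': "y \<in> carrier G" using S(1) y by blast
    have "y \<in> center_mod N"
      by (rule mem_center_mod_if_generators[OF base(1) y' gen S(1)]) (rule comm_S[OF _ y])
    then have "comm g y \<in> N" using g by (simp add: center_mod_def)
    then show ?thesis using comm_swap[OF g y'] N.m_inv_closed by metis
  qed
  then have "g \<in> center_mod N"
    by (rule mem_center_mod_if_generators[OF base(1) g gen S(1)])
  then show ?case using u by (simp add: center_mod_def)
next
  case (Suc c)
  have law: "inv (qterm G c y x z) \<otimes> qterm G c x y z \<in> center_mod N"
    if xy: "x \<in> S" "y \<in> S" and z: "\<And>i. z i \<in> S" for x y z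
  proof (rule inv_mult_mem_center_mod[OF Suc.prems(1) _ _ gen S])
    have carr: "x \<in> carrier G" "y \<in> carrier G" "z i \<in> carrier G" for i
      using S(1) xy z by blast+
    show "qterm G c x y z \<in> carrier G" "qterm G c y x z \<in> carrier G"
      using carr by (auto intro: qterm_closed[OF Suc.hyps])
    fix w assume w: "w \<in> S"
    \<comment> \<open>the variable \<open>z c\<close> does not occur in the terms of level \<open>c\<close>, so it can be chosen freely\<close>
    have same: "qterm G c p q (z(c := w)) = qterm G c p q z" for p q
      using Suc.hyps by (intro qterm_cong) simp_all
    have Suc_c: "qterm G (Suc c) p q (z(c := w)) = qterm G c p q z \<otimes> w \<otimes> qterm G c q p z" for p q
    proof -
      obtain c' where "c = Suc c'" using Suc.hyps by (cases c) simp_all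
      then show ?thesis using same by (simp del: fun_upd_apply add: fun_upd_same)
    qed
    have "(z(c := w)) i \<in> S" for i using z w by simp
    then show "inv (qterm G c y x z \<otimes> w \<otimes> qterm G c x y z)
        \<otimes> (qterm G c x y z \<otimes> w \<otimes> qterm G c y x z) \<in> N"
      using Suc.prems(2)[OF xy, of "z(c := w)"] by (simp only: Suc_c)
  qed
  have "(comm u ^^ c) g \<in> center_mod N"
    by (rule Suc.IH[OF normal_center_mod[OF Suc.prems(1)] law])
  then show ?case using u by (simp add: center_mod_def)
qed

section \<open>Engel elements and preorders on a group\<close>

definition conj_seq :: "'a \<Rightarrow> 'a \<Rightarrow> nat \<Rightarrow> 'a" where
  "conj_seq u g k = inv (u [^] k) \<otimes> g \<otimes> u [^] k"

lemma conj_seq_closed [simp]: "\<lbrakk>u \<in> carrier G; g \<in> carrier G\<rbrakk> \<Longrightarrow> conj_seq u g k \<in> carrier G"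
  by (simp add: conj_seq_def)

text \<open>Passing from \<open>g\<close> to \<open>[g, u]\<close> is the difference operator on these sequences.\<close>

lemma conj_seq_comm:
  assumes "u \<in> carrier G" "g \<in> carrier G"
  shows "conj_seq u (comm u g) k = inv (conj_seq u g k) \<otimes> conj_seq u g (Suc k)"
proof -
  have "u [^] Suc k = u \<otimes> u [^] k" using assms by (metis nat_pow_Suc2)
  then show ?thesis
    using assms by (simp add: conj_seq_def comm_def inv_mult_group m_assoc del: nat_pow_Suc)
qed

end

text \<open>A left-invariant total preorder on a group, given by its cone \<open>Pos\<close> of elements above the
  unit.\<close>

locale preordered_group = group +
  fixes Pos
  assumes Pos_subset: "Pos \<subseteq> carrier G"
    and Pos_one: "\<one> \<in> Pos"
    and Pos_mult: "\<lbrakk>g \<in> Pos; h \<in> Pos\<rbrakk> \<Longrightarrow> g \<otimes> h \<in> Pos"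
    and Pos_total: "g \<in> carrier G \<Longrightarrow> g \<in> Pos \<or> inv g \<in> Pos"
begin

definition le :: "'a \<Rightarrow> 'a \<Rightarrow> bool" where "le g h \<longleftrightarrow> inv g \<otimes> h \<in> Pos"

lemma le_trans:
  assumes "le g h" "le h k" "g \<in> carrier G" "h \<in> carrier G" "k \<in> carrier G"
  shows "le g k"
  using Pos_mult[of "inv g \<otimes> h" "inv h \<otimes> k"] assms by (simp add: le_def m_assoc)

lemma le_refl: "g \<in> carrier G \<Longrightarrow> le g g"
  by (simp add: le_def Pos_one)

lemma le_total: "\<lbrakk>g \<in> carrier G; h \<in> carrier G\<rbrakk> \<Longrightarrow> le g h \<or> le h g"
  using Pos_total[of "inv g \<otimes> h"] by (simp add: le_def inv_mult_group)

lemma conj_seq_comm_Pos: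
  assumes "u \<in> carrier G" "g \<in> carrier G"
  shows "le \<one> (conj_seq u (comm u g) k) \<longleftrightarrow> le (conj_seq u g k) (conj_seq u g (Suc k))"
    and "le (conj_seq u (comm u g) k) \<one> \<longleftrightarrow> le (conj_seq u g (Suc k)) (conj_seq u g k)"
  using assms by (simp_all add: conj_seq_comm le_def inv_mult_group)

lemma le_lift_Suc:
  assumes "\<And>k. k \<ge> K \<Longrightarrow> le (f k) (f (Suc k))" "\<And>k. f k \<in> carrier G" "K \<le> k" "k \<le> l"
  shows "le (f k) (f l)"
  using assms(4)
proof (induction l rule: dec_induct)
  case (step n) then show ?case using assms le_trans[of "f k" "f n" "f (Suc n)"] by simp
qed (simp add: assms le_refl)

lemma ge_lift_Suc:
  assumes "\<And>k. k \<ge> K \<Longrightarrow> le (f (Suc k)) (f k)" "\<And>k. f k \<in> carrier G" "K \<le> k" "k \<le> l"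
  shows "le (f l) (f k)"
  using assms(4)
proof (induction l rule: dec_induct)
  case (step n) then show ?case using assms le_trans[of "f (Suc n)" "f n" "f k"] by simp
qed (simp add: assms le_refl)

text \<open>Discrete analogue of the fact that a polynomial has an eventually constant sign: the
  difference has one by induction, so the sequence is eventually monotone, and a monotone sequence
  changes sign at most once.\<close>

lemma engel_conj_seq_constant_sign:
  assumes u: "u \<in> carrier G" and "g \<in> carrier G" "(comm u ^^ n) g = \<one>"
  shows "\<exists>K. (\<forall>k\<ge>K. le \<one> (conj_seq u g k)) \<or> (\<forall>k\<ge>K. le (conj_seq u g k) \<one>)"
  using assms(2,3)
proof (induction n arbitrary: g)
  case 0
  then show ?case using u by (simp add: conj_seq_def le_refl)
next
  case (Suc n)
  let ?f = "conj_seq u g"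
  have cl: "?f k \<in> carrier G" for k using u Suc.prems by simp
  have "(comm u ^^ n) (comm u g) = \<one>" using Suc.prems(2) by (simp add: funpow_swap1)
  then obtain K where "(\<forall>k\<ge>K. le (?f k) (?f (Suc k))) \<or> (\<forall>k\<ge>K. le (?f (Suc k)) (?f k))"
    using Suc.IH[of "comm u g"] Suc.prems(1) u by (auto simp: conj_seq_comm_Pos)
  then show ?case
  proof
    assume "\<forall>k\<ge>K. le (?f k) (?f (Suc k))"
    then have up: "le (?f k) (?f l)" if "K \<le> k" "k \<le> l" for k l
      using that le_lift_Suc[of K ?f k l] cl by simp
    show ?thesis
    proof (cases "\<exists>k\<ge>K. le \<one> (?f k)")
      case True
      then obtain m where "m \<ge> K" "le \<one> (?f m)" by blast
      then have "\<forall>k\<ge>m. le \<one> (?f k)"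
        using le_trans[OF _ up] cl by simp
      then show ?thesis by blast
    next
      case False
      then have "\<forall>k\<ge>K. le (?f k) \<one>" using le_total[OF one_closed cl] by blast
      then show ?thesis by blast
    qed
  next
    assume "\<forall>k\<ge>K. le (?f (Suc k)) (?f k)"
    then have down: "le (?f l) (?f k)" if "K \<le> k" "k \<le> l" for k l
      using that ge_lift_Suc[of K ?f k l] cl by simp
    show ?thesis
    proof (cases "\<exists>k\<ge>K. le (?f k) \<one>")
      case True
      then obtain m where "m \<ge> K" "le (?f m) \<one>" by blast
      then have "\<forall>k\<ge>m. le (?f k) \<one>"
        using le_trans[OF down] cl by simp
      then show ?thesis by blast
    next
      case False
      then have "\<forall>k\<ge>K. le \<one> (?f k)" using le_total[OF one_closed cl] by blast
      then show ?thesis by blast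
    qed
  qed
qed

text \<open>Discrete analogue of the fact that a polynomial vanishing eventually is zero: the difference
  vanishes everywhere by induction, so the sequence is constant up to equivalence.\<close>

lemma engel_conj_seq_eventually_trivial:
  assumes u: "u \<in> carrier G" and "g \<in> carrier G" "(comm u ^^ n) g = \<one>"
    and "\<And>k. k \<ge> K \<Longrightarrow> le \<one> (conj_seq u g k) \<and> le (conj_seq u g k) \<one>"
  shows "le \<one> (conj_seq u g k) \<and> le (conj_seq u g k) \<one>"
  using assms(2-)
proof (induction n arbitrary: g k)
  case 0
  then show ?case using u by (simp add: conj_seq_def le_refl)
next
  case (Suc n)
  let ?f = "conj_seq u g"
  have cl: "?f k \<in> carrier G" for k using u Suc.prems by simp
  have "(comm u ^^ n) (comm u g) = \<one>" using Suc.prems(2) by (simp add: funpow_swap1)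
  moreover have "le \<one> (conj_seq u (comm u g) k) \<and> le (conj_seq u (comm u g) k) \<one>" if "k \<ge> K" for k
    using Suc.prems(3)[of k] Suc.prems(3)[of "Suc k"] that u Suc.prems(1)
      le_trans[OF _ _ cl one_closed cl] by (simp add: conj_seq_comm_Pos)
  ultimately have same: "le (?f k) (?f (Suc k))" "le (?f (Suc k)) (?f k)" for k
    using Suc.IH[of "comm u g"] Suc.prems(1) u by (auto simp: conj_seq_comm_Pos)
  have "le (?f k) (?f (k + K))" "le (?f (k + K)) (?f k)"
    using le_lift_Suc[of k ?f k "k + K"] ge_lift_Suc[of k ?f k "k + K"] same cl by simp_all
  moreover have "le \<one> (?f (k + K))" "le (?f (k + K)) \<one>" using Suc.prems(3)[of "k + K"] by simp_all
  ultimately show ?case using le_trans[OF _ _ one_closed cl cl] le_trans[OF _ _ cl cl one_closed] by blast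
qed

text \<open>The sequence is eventually monotone. If it increases, then it stays above the unit after the
  first return to it; if it decreases, then from some index on each member is above a later one that
  is equivalent to the unit. In both cases it is eventually equivalent to the unit.\<close>

theorem engel_conj_seq_trivial:
  assumes u: "u \<in> carrier G" and x: "x \<in> carrier G" and engel: "(comm u ^^ n) x = \<one>"
    and neg: "\<And>k. le (conj_seq u x k) \<one>" and inf: "\<And>m. \<exists>k\<ge>m. le \<one> (conj_seq u x k)"
  shows "le \<one> (conj_seq u x k)"
proof -
  let ?f = "conj_seq u x"
  have cl: "?f k \<in> carrier G" for k using u x by simp
  have "comm u \<one> = \<one>" using u by (simp add: comm_def)
  then have "(comm u ^^ n) (comm u x) = \<one>" by (metis engel funpow.simps(2) funpow_swap1 o_apply)
  then obtain K where "(\<forall>k\<ge>K. le (?f k) (?f (Suc k))) \<or> (\<forall>k\<ge>K. le (?f (Suc k)) (?f k))"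
    using engel_conj_seq_constant_sign[of u "comm u x" n] u x by (auto simp: conj_seq_comm_Pos)
  then have "\<exists>K. \<forall>k\<ge>K. le \<one> (?f k)"
  proof
    assume "\<forall>k\<ge>K. le (?f k) (?f (Suc k))"
    then have up: "le (?f k) (?f l)" if "K \<le> k" "k \<le> l" for k l
      using that le_lift_Suc[of K ?f k l] cl by simp
    obtain k where "k \<ge> K" "le \<one> (?f k)" using inf by blast
    then have "\<forall>l\<ge>k. le \<one> (?f l)"
      using le_trans[OF _ up] cl by simp
    then show ?thesis by blast
  next
    assume "\<forall>k\<ge>K. le (?f (Suc k)) (?f k)"
    then have down: "le (?f l) (?f k)" if "K \<le> k" "k \<le> l" for k l
      using that ge_lift_Suc[of K ?f k l] cl by simp
    have "le \<one> (?f k)" if "k \<ge> K" for k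
    proof -
      obtain l where "l \<ge> k" "le \<one> (?f l)" using inf by blast
      then show ?thesis using le_trans[OF _ down[OF that]] cl by simp
    qed
    then show ?thesis by blast
  qed
  then show ?thesis using engel_conj_seq_eventually_trivial[OF u x engel] neg by blast
qed

end

section \<open>Prelinear cancellative residuated lattices\<close>

locale prelinear_cancellative_rl = residuated_lattice L + monoid_cancel L for L (structure) +
  assumes prelinear: "prelinear L"
begin

lemma lres_prelinear:
  "\<lbrakk>x \<in> carrier L; y \<in> carrier L\<rbrakk> \<Longrightarrow> (x \<setminus> y \<^bold>\<and> \<one>) \<^bold>\<or> (y \<setminus> x \<^bold>\<and> \<one>) = \<one>"
  and rres_prelinear:
  "\<lbrakk>x \<in> carrier L; y \<in> carrier L\<rbrakk> \<Longrightarrow> (x \<^bold>/ y \<^bold>\<and> \<one>) \<^bold>\<or> (y \<^bold>/ x \<^bold>\<and> \<one>) = \<one>"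
  using prelinear by (simp_all add: prelinear_def)

lemma mult_le_cancel_left:
  assumes "a \<in> carrier L" "b \<in> carrier L" "c \<in> carrier L"
  shows "c \<otimes> a \<preceq> c \<otimes> b \<longleftrightarrow> a \<preceq> b"
proof
  assume "c \<otimes> a \<preceq> c \<otimes> b"
  then have "c \<otimes> (a \<^bold>\<or> b) = c \<otimes> b" using assms by (simp add: le_join_iff mult_join_distrib)
  then show "a \<preceq> b" using assms l_cancel[of c "a \<^bold>\<or> b" b] by (simp add: le_join_iff)
qed (use assms mult_left_mono in auto)

lemma mult_le_cancel_right:
  assumes "a \<in> carrier L" "b \<in> carrier L" "c \<in> carrier L"
  shows "a \<otimes> c \<preceq> b \<otimes> c \<longleftrightarrow> a \<preceq> b"
proof
  assume "a \<otimes> c \<preceq> b \<otimes> c"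
  then have "(a \<^bold>\<or> b) \<otimes> c = b \<otimes> c" using assms by (simp add: le_join_iff mult_join_distrib)
  then show "a \<preceq> b" using assms r_cancel[of "a \<^bold>\<or> b" c b] by (simp add: le_join_iff)
qed (use assms mult_right_mono in auto)

definition orth :: "'a \<Rightarrow> 'a \<Rightarrow> bool" where
  "orth x y \<longleftrightarrow> x \<in> carrier L \<and> y \<in> carrier L \<and> x \<^bold>\<or> y = \<one>"

lemma orthD: "orth x y \<Longrightarrow> x \<in> carrier L \<and> y \<in> carrier L \<and> x \<preceq> \<one> \<and> y \<preceq> \<one>"
  using join_ge[of x y] by (auto simp: orth_def)

lemma orth_sym: "orth x y \<Longrightarrow> orth y x"
  by (simp add: orth_def join_comm)

lemma orth_mono:
  assumes "orth x y" "y \<preceq> y'" "y' \<preceq> \<one>" "y' \<in> carrier L"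
  shows "orth x y'"
proof -
  have xy: "x \<in> carrier L" "y \<in> carrier L" "x \<preceq> \<one>" "x \<^bold>\<or> y = \<one>"
    using assms(1) orthD[OF assms(1)] by (auto simp: orth_def)
  have "y \<preceq> x \<^bold>\<or> y'" using le_trans[OF assms(2) join_ge(2)] xy(1,2) assms(4) by blast
  then have "\<one> \<preceq> x \<^bold>\<or> y'" using xy assms(4) join_le_iff[of x y "x \<^bold>\<or> y'"] by simp
  moreover have "x \<^bold>\<or> y' \<preceq> \<one>" using xy assms(3,4) by (simp add: join_le_iff)
  ultimately show ?thesis using xy assms(4) le_antisym by (simp add: orth_def)
qed

lemma orth_mult:
  assumes "orth x y" "orth x z"
  shows "orth x (y \<otimes> z)"
proof -
  have xyz: "x \<in> carrier L" "y \<in> carrier L" "z \<in> carrier L" "x \<preceq> \<one>" "y \<preceq> \<one>" "z \<preceq> \<one>"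
    and eq: "x \<^bold>\<or> y = \<one>" "x \<^bold>\<or> z = \<one>"
    using orthD[OF assms(1)] orthD[OF assms(2)] assms by (auto simp: orth_def)
  have "x \<otimes> z \<preceq> x \<^bold>\<or> y \<otimes> z"
    using le_trans[OF mult_le_left join_ge(1)] xyz by simp
  then have 1: "z \<preceq> x \<^bold>\<or> y \<otimes> z"
    using xyz eq(1) mult_join_le_iff(2)[of x y "x \<^bold>\<or> y \<otimes> z" z] by simp
  then have "\<one> \<preceq> x \<^bold>\<or> y \<otimes> z"
    using xyz eq(2) join_le_iff[of x z "x \<^bold>\<or> y \<otimes> z"] by simp
  moreover have "x \<^bold>\<or> y \<otimes> z \<preceq> \<one>"
    using xyz le_trans[OF mult_le_left[of z y], of \<one>] by (simp add: join_le_iff)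
  ultimately show ?thesis using xyz le_antisym by (simp add: orth_def)
qed

section \<open>Maximal ideals of the negative cone\<close>

definition cone_ideal :: "'a set \<Rightarrow> bool" where
  "cone_ideal D \<longleftrightarrow> D \<subseteq> {a \<in> carrier L. a \<preceq> \<one>} - {\<one>} \<and>
     (\<forall>a\<in>D. \<forall>b\<in>D. a \<^bold>\<or> b \<in> D) \<and> (\<forall>a\<in>D. \<forall>b\<in>carrier L. b \<preceq> a \<longrightarrow> b \<in> D)"

definition maximal_cone_ideal :: "'a set \<Rightarrow> bool" where
  "maximal_cone_ideal D \<longleftrightarrow> cone_ideal D \<and>
     (\<forall>a\<in>carrier L. a \<preceq> \<one> \<longrightarrow> a \<notin> D \<longrightarrow> (\<exists>x\<in>D. orth x a))"

lemma cone_idealD: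
  assumes "cone_ideal D" "a \<in> D"
  shows "a \<in> carrier L" "a \<preceq> \<one>" "a \<noteq> \<one>"
  using assms by (auto simp: cone_ideal_def)

lemma cone_ideal_join: "\<lbrakk>cone_ideal D; a \<in> D; b \<in> D\<rbrakk> \<Longrightarrow> a \<^bold>\<or> b \<in> D"
  by (simp add: cone_ideal_def)

lemma cone_ideal_down: "\<lbrakk>cone_ideal D; a \<in> D; b \<in> carrier L; b \<preceq> a\<rbrakk> \<Longrightarrow> b \<in> D"
  by (simp add: cone_ideal_def)

lemma cone_idealI:
  assumes "\<And>a. a \<in> D \<Longrightarrow> a \<in> carrier L \<and> a \<preceq> \<one> \<and> a \<noteq> \<one>"
    and "\<And>a b. \<lbrakk>a \<in> D; b \<in> D\<rbrakk> \<Longrightarrow> a \<^bold>\<or> b \<in> D"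
    and "\<And>a b. \<lbrakk>a \<in> D; b \<in> carrier L; b \<preceq> a\<rbrakk> \<Longrightarrow> b \<in> D"
  shows "cone_ideal D"
  unfolding cone_ideal_def using assms by blast

text \<open>By Zorn's lemma. If \<open>a\<close> is orthogonal to no member of \<open>D\<close>, then the ideal generated by \<open>D\<close> and
  \<open>a\<close> is still proper. The empty set is an ideal in the sense of \<open>cone_ideal\<close>, but never a maximal
  one, because some member has to be orthogonal to the unit.\<close>

lemma ex_maximal_cone_ideal:
  assumes t: "t \<in> carrier L" "t \<preceq> \<one>" "t \<noteq> \<one>"
  obtains D where "maximal_cone_ideal D" "t \<in> D"
proof -
  let ?A = "{D. cone_ideal D \<and> t \<in> D}"
  have "cone_ideal {a \<in> carrier L. a \<preceq> t}"
  proof (rule cone_idealI)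
    fix a b assume a: "a \<in> {a \<in> carrier L. a \<preceq> t}"
    show "a \<in> carrier L \<and> a \<preceq> \<one> \<and> a \<noteq> \<one>"
      using a t le_trans[of a t \<one>] le_antisym[of t \<one>] by auto
    show "a \<^bold>\<or> b \<in> {a \<in> carrier L. a \<preceq> t}" if "b \<in> {a \<in> carrier L. a \<preceq> t}"
      using a that t by (simp add: join_le_iff)
    show "b \<in> {a \<in> carrier L. a \<preceq> t}" if "b \<in> carrier L" "b \<preceq> a"
      using a that t le_trans[of b a t] by simp
  qed
  then have "{a \<in> carrier L. a \<preceq> t} \<in> ?A" using t by simp
  moreover have "\<Union>\<C> \<in> ?A" if C: "\<C> \<noteq> {}" "subset.chain ?A \<C>" for \<C>
  proof -
    have mem: "cone_ideal D" "t \<in> D" if "D \<in> \<C>" for D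
      using C(2) that unfolding subset_chain_def by blast+
    have "cone_ideal (\<Union>\<C>)"
    proof (rule cone_idealI)
      fix a b assume a: "a \<in> \<Union>\<C>"
      then obtain D where D: "D \<in> \<C>" "a \<in> D" by blast
      show "a \<in> carrier L \<and> a \<preceq> \<one> \<and> a \<noteq> \<one>"
        using cone_idealD[OF mem(1)[OF D(1)] D(2)] by simp
      show "b \<in> \<Union>\<C>" if "b \<in> carrier L" "b \<preceq> a"
        using cone_ideal_down[OF mem(1)[OF D(1)] D(2) that] D(1) by blast
      assume "b \<in> \<Union>\<C>"
      then obtain D' where "D' \<in> \<C>" "a \<in> D'" "b \<in> D'"
        using C(2) D unfolding subset_chain_def by blast
      then show "a \<^bold>\<or> b \<in> \<Union>\<C>" using cone_ideal_join[OF mem(1)] by blast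
    qed
    then show ?thesis using mem(2) C(1) by blast
  qed
  ultimately obtain D where D: "cone_ideal D" "t \<in> D"
    and max: "\<And>D'. \<lbrakk>cone_ideal D'; D \<subseteq> D'\<rbrakk> \<Longrightarrow> D' = D"
    using subset_Zorn_nonempty[of ?A] by blast
  have "\<exists>x\<in>D. orth x a" if a: "a \<in> carrier L" "a \<preceq> \<one>" "a \<notin> D" for a
  proof (rule ccontr)
    assume no: "\<not> (\<exists>x\<in>D. orth x a)"
    let ?D' = "{b \<in> carrier L. \<exists>x\<in>D. b \<preceq> x \<^bold>\<or> a}"
    have Dc: "x \<in> carrier L" "x \<preceq> \<one>" if "x \<in> D" for x using D(1) that cone_idealD by auto
    have below: "x \<^bold>\<or> a \<preceq> \<one>" if "x \<in> D" for x using Dc[OF that] a by (simp add: join_le_iff)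
    have ideal': "cone_ideal ?D'"
    proof (rule cone_idealI)
      fix b b' assume "b \<in> ?D'"
      then obtain x where x: "b \<in> carrier L" "x \<in> D" "b \<preceq> x \<^bold>\<or> a" by blast
      note xc = Dc[OF x(2)]
      have "b \<preceq> \<one>" using le_trans[OF x(3) below[OF x(2)]] x(1) xc a by simp
      moreover have "b \<noteq> \<one>"
      proof
        assume "b = \<one>"
        then have "x \<^bold>\<or> a = \<one>" using le_antisym[OF below[OF x(2)]] x xc a by simp
        then show False using no x xc a by (auto simp: orth_def)
      qed
      ultimately show "b \<in> carrier L \<and> b \<preceq> \<one> \<and> b \<noteq> \<one>" using x(1) by simp
      show "b' \<in> ?D'" if b': "b' \<in> carrier L" "b' \<preceq> b"
      proof -
        have "b' \<preceq> x \<^bold>\<or> a" using le_trans[OF b'(2) x(3)] b'(1) x(1) xc a by simp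
        then show ?thesis using b'(1) x(2) by blast
      qed
      assume "b' \<in> ?D'"
      then obtain x' where x': "b' \<in> carrier L" "x' \<in> D" "b' \<preceq> x' \<^bold>\<or> a" by blast
      note xc' = Dc[OF x'(2)]
      let ?j = "x \<^bold>\<or> x'"
      have up: "x \<^bold>\<or> a \<preceq> ?j \<^bold>\<or> a" "x' \<^bold>\<or> a \<preceq> ?j \<^bold>\<or> a"
        using xc xc' a le_trans[of x ?j "?j \<^bold>\<or> a"] le_trans[of x' ?j "?j \<^bold>\<or> a"]
        by (simp_all add: join_le_iff)
      have "b \<^bold>\<or> b' \<preceq> ?j \<^bold>\<or> a"
        using le_trans[OF x(3) up(1)] le_trans[OF x'(3) up(2)] xc xc' a x(1) x'(1)
        by (simp add: join_le_iff)
      then show "b \<^bold>\<or> b' \<in> ?D'"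
        using cone_ideal_join[OF D(1) x(2) x'(2)] x(1) x'(1) by blast
    qed
    have "D \<subseteq> ?D'"
    proof
      fix x assume "x \<in> D"
      then show "x \<in> ?D'" using Dc a by (auto intro!: bexI[of _ x])
    qed
    then have "?D' = D" by (rule max[OF ideal'])
    moreover have "a \<in> ?D'" using D(2) Dc[OF D(2)] a by (auto intro!: bexI[of _ t])
    ultimately show False using a(3) by simp
  qed
  then have "maximal_cone_ideal D" using D(1) unfolding maximal_cone_ideal_def by blast
  then show ?thesis using D(2) by (rule that)
qed

definition polar :: "'a set \<Rightarrow> 'a set" where
  "polar D = {h. \<exists>x\<in>D. orth x h}"

end

locale prime_filter = prelinear_cancellative_rl L for L (structure) +
  fixes H
  assumes H_subset: "h \<in> H \<Longrightarrow> h \<in> carrier L \<and> h \<preceq> \<one>"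
    and H_one: "\<one> \<in> H"
    and H_mult: "\<lbrakk>h \<in> H; k \<in> H\<rbrakk> \<Longrightarrow> h \<otimes> k \<in> H"
    and H_up: "\<lbrakk>h \<in> H; h \<preceq> k; k \<preceq> \<one>; k \<in> carrier L\<rbrakk> \<Longrightarrow> k \<in> H"
    and H_prime: "orth x y \<Longrightarrow> x \<in> H \<or> y \<in> H"

text \<open>If \<open>x\<close> and \<open>y\<close> are orthogonal and \<open>x\<close> belongs to \<open>D\<close>, then \<open>y\<close> is in the polar by
  definition; otherwise \<open>x\<close> is in it by maximality. Closure under multiplication holds because two
  members of \<open>D\<close> can be replaced by their join.\<close>

lemma (in prelinear_cancellative_rl) prime_filter_polar:
  assumes "maximal_cone_ideal D"
  shows "prime_filter L (polar D)"
proof unfold_locales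
  have ideal: "cone_ideal D" and max: "\<And>a. \<lbrakk>a \<in> carrier L; a \<preceq> \<one>; a \<notin> D\<rbrakk> \<Longrightarrow> \<exists>x\<in>D. orth x a"
    using assms by (auto simp: maximal_cone_ideal_def)
  note carr = cone_idealD(1,2)[OF ideal]
  have join: "x \<^bold>\<or> y \<in> D" if "x \<in> D" "y \<in> D" for x y
    using ideal that by (simp add: cone_ideal_def)
  fix h k x y
  show "h \<in> carrier L \<and> h \<preceq> \<one>" if "h \<in> polar D" using that orthD by (auto simp: polar_def)
  show "\<one> \<in> polar D" using max[of \<one>] cone_idealD(3)[OF ideal] by (auto simp: polar_def)
  show "h \<otimes> k \<in> polar D" if hk: "h \<in> polar D" "k \<in> polar D"
  proof -
    obtain x y where xy: "x \<in> D" "orth x h" "y \<in> D" "orth y k" using hk unfolding polar_def by blast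
    have j: "x \<^bold>\<or> y \<in> D" by (rule join[OF xy(1,3)])
    have o: "orth h (x \<^bold>\<or> y)" "orth k (x \<^bold>\<or> y)"
      using orth_mono[OF orth_sym[OF xy(2)], of "x \<^bold>\<or> y"] orth_mono[OF orth_sym[OF xy(4)], of "x \<^bold>\<or> y"]
        carr[OF j] carr[OF xy(1)] carr[OF xy(3)] by simp_all
    show ?thesis
      using orth_mult[OF o[THEN orth_sym]] j by (auto simp: polar_def)
  qed
  show "k \<in> polar D" if "h \<in> polar D" "h \<preceq> k" "k \<preceq> \<one>" "k \<in> carrier L"
    using that(1) orth_mono[OF _ that(2-4)] unfolding polar_def by blast
  show "x \<in> polar D \<or> y \<in> polar D" if "orth x y"
    using that max[of x] orthD[OF that] unfolding polar_def by blast
qed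

context prime_filter
begin

text \<open>The preorder \<open>\<le>\<^sub>H\<close> of the introduction.\<close>

definition le_mod :: "'a \<Rightarrow> 'a \<Rightarrow> bool" where
  "le_mod a b \<longleftrightarrow> (\<exists>h\<in>H. a \<otimes> h \<preceq> b)"

lemma le_mod_iff_lres:
  assumes "a \<in> carrier L" "b \<in> carrier L"
  shows "le_mod a b \<longleftrightarrow> a \<setminus> b \<^bold>\<and> \<one> \<in> H"
proof
  assume "le_mod a b"
  then obtain h where h: "h \<in> H" "a \<otimes> h \<preceq> b" by (auto simp: le_mod_def)
  then have "h \<preceq> a \<setminus> b"
    using H_subset[OF h(1)] assms lres_adjoint[of a h b] by simp
  then have "h \<preceq> a \<setminus> b \<^bold>\<and> \<one>"
    using H_subset[OF h(1)] assms by (simp add: le_meet_iff)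
  then show "a \<setminus> b \<^bold>\<and> \<one> \<in> H"
    using assms by (intro H_up[OF h(1)]) simp_all
next
  assume "a \<setminus> b \<^bold>\<and> \<one> \<in> H"
  moreover have "a \<otimes> (a \<setminus> b \<^bold>\<and> \<one>) \<preceq> b"
    using assms by (simp add: lres_adjoint)
  ultimately show "le_mod a b" by (auto simp: le_mod_def)
qed

lemma le_imp_le_mod: "\<lbrakk>a \<preceq> b; a \<in> carrier L; b \<in> carrier L\<rbrakk> \<Longrightarrow> le_mod a b"
  unfolding le_mod_def using H_one by (intro bexI[of _ \<one>]) simp_all

lemma le_mod_trans:
  assumes "le_mod a b" "le_mod b d" and [simp]: "a \<in> carrier L" "b \<in> carrier L" "d \<in> carrier L"
  shows "le_mod a d"
proof -
  obtain h k where hk: "h \<in> H" "k \<in> H" "a \<otimes> h \<preceq> b" "b \<otimes> k \<preceq> d"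
    using assms(1,2) by (auto simp: le_mod_def)
  note [simp] = H_subset[OF hk(1)] H_subset[OF hk(2)]
  have "a \<otimes> h \<otimes> k \<preceq> b \<otimes> k" using mult_right_mono[OF hk(3)] by simp
  then have "a \<otimes> (h \<otimes> k) \<preceq> d" using le_trans[OF _ hk(4)] by (simp add: m_assoc)
  then show ?thesis using H_mult hk by (auto simp: le_mod_def)
qed

lemma le_mod_total: "\<lbrakk>a \<in> carrier L; b \<in> carrier L\<rbrakk> \<Longrightarrow> le_mod a b \<or> le_mod b a"
  using H_prime[of "a \<setminus> b \<^bold>\<and> \<one>" "b \<setminus> a \<^bold>\<and> \<one>"] lres_prelinear[of a b]
  by (simp add: le_mod_iff_lres orth_def)

lemma le_mod_mult_left_iff:
  assumes "a \<in> carrier L" "b \<in> carrier L" "c \<in> carrier L"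
  shows "le_mod (c \<otimes> a) (c \<otimes> b) \<longleftrightarrow> le_mod a b"
proof -
  have "c \<otimes> a \<otimes> h \<preceq> c \<otimes> b \<longleftrightarrow> a \<otimes> h \<preceq> b" if "h \<in> H" for h
    using assms H_subset[OF that] by (simp add: m_assoc mult_le_cancel_left)
  then show ?thesis by (auto simp: le_mod_def)
qed

text \<open>On each coset one of two orthogonal elements acts trivially: if \<open>x w h \<le> y w\<close> with \<open>h \<in> H\<close>,
  then \<open>w h = x w h \<or> y w h \<le> y w\<close>.\<close>

lemma le_mod_orth:
  assumes o: "orth x y" and w: "w \<in> carrier L"
  shows "le_mod w (x \<otimes> w) \<or> le_mod w (y \<otimes> w)"
proof -
  have xy: "x \<in> carrier L" "y \<in> carrier L" "x \<preceq> \<one>" "y \<preceq> \<one>" "x \<^bold>\<or> y = \<one>"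
    using o orthD[OF o] by (auto simp: orth_def)
  have step: "le_mod w (b \<otimes> w)"
    if ab: "le_mod (a \<otimes> w) (b \<otimes> w)" "a \<in> carrier L" "b \<in> carrier L" "b \<preceq> \<one>" "a \<^bold>\<or> b = \<one>" for a b
  proof -
    obtain h where h: "h \<in> H" "a \<otimes> w \<otimes> h \<preceq> b \<otimes> w" using ab(1) by (auto simp: le_mod_def)
    note hc = H_subset[OF h(1)]
    have "b \<otimes> (w \<otimes> h) \<preceq> b \<otimes> w"
      using mult_left_mono[OF mult_le_left[of h w]] hc w ab(3) by simp
    then have "(a \<^bold>\<or> b) \<otimes> (w \<otimes> h) \<preceq> b \<otimes> w"
      using h(2) hc w ab(2,3) by (simp add: mult_join_le_iff m_assoc)
    then have "w \<otimes> h \<preceq> b \<otimes> w" using ab(5) hc w by simp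
    then show ?thesis using h(1) by (auto simp: le_mod_def)
  qed
  have yx: "y \<^bold>\<or> x = \<one>" using xy join_comm[of x y] by simp
  have "le_mod (x \<otimes> w) (y \<otimes> w) \<or> le_mod (y \<otimes> w) (x \<otimes> w)" using le_mod_total xy(1,2) w by simp
  then show ?thesis using step[OF _ xy(1,2,4,5)] step[OF _ xy(2,1,3) yx] by blast
qed

end

section \<open>Cancellative monoids satisfying a nilpotent law\<close>

text \<open>The two sides of the law end in different variables, so that the law yields common left
  multiples.\<close>

lemma (in monoid) qterm_last_factor:
  assumes "c \<ge> 1" "x \<in> carrier G" "y \<in> carrier G" "\<And>i. z i \<in> carrier G"
  shows "\<exists>s\<in>carrier G. \<exists>t\<in>carrier G.
    (qterm G c x y z = s \<otimes> y \<and> qterm G c y x z = t \<otimes> x) \<or>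
    (qterm G c x y z = s \<otimes> x \<and> qterm G c y x z = t \<otimes> y)"
  using assms(1)
proof (induction c rule: nat_induct_at_least)
  case base
  then show ?case using assms by auto
next
  case (Suc c)
  obtain c' where c': "c = Suc c'" using Suc.hyps by (cases c) simp_all
  obtain s t where st: "s \<in> carrier G" "t \<in> carrier G"
    "(qterm G c x y z = s \<otimes> y \<and> qterm G c y x z = t \<otimes> x) \<or>
     (qterm G c x y z = s \<otimes> x \<and> qterm G c y x z = t \<otimes> y)"
    using Suc.IH by blast
  have carr: "qterm G c x y z \<in> carrier G" "qterm G c y x z \<in> carrier G"
    using st assms by auto
  let ?s = "qterm G c x y z \<otimes> z c \<otimes> t" and ?t = "qterm G c y x z \<otimes> z c \<otimes> s"
  have "(qterm G (Suc c) x y z = ?s \<otimes> x \<and> qterm G (Suc c) y x z = ?t \<otimes> y) \<or>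
     (qterm G (Suc c) x y z = ?s \<otimes> y \<and> qterm G (Suc c) y x z = ?t \<otimes> x)"
    using st(3)
  proof (elim disjE conjE)
    assume e: "qterm G c x y z = s \<otimes> y" "qterm G c y x z = t \<otimes> x"
    have "qterm G (Suc c) x y z = qterm G c x y z \<otimes> z c \<otimes> (t \<otimes> x)"
      "qterm G (Suc c) y x z = qterm G c y x z \<otimes> z c \<otimes> (s \<otimes> y)"
      unfolding e[symmetric] by (simp_all add: c')
    then show ?thesis using carr st assms by (simp add: m_assoc)
  next
    assume e: "qterm G c x y z = s \<otimes> x" "qterm G c y x z = t \<otimes> y"
    have "qterm G (Suc c) x y z = qterm G c x y z \<otimes> z c \<otimes> (t \<otimes> y)"
      "qterm G (Suc c) y x z = qterm G c y x z \<otimes> z c \<otimes> (s \<otimes> x)"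
      unfolding e[symmetric] by (simp_all add: c')
    then show ?thesis using carr st assms by (simp add: m_assoc)
  qed
  moreover have "?s \<in> carrier G" "?t \<in> carrier G" using carr st assms by auto
  ultimately show ?case by blast
qed

lemma (in monoid_cancel) ore_monoid_of_nilpotent:
  assumes "nilpotent G"
  shows "ore_monoid G"
proof unfold_locales
  fix a b assume ab: "a \<in> carrier G" "b \<in> carrier G"
  obtain c where c: "c \<ge> 1" "c_nilpotent c G" using assms by (auto simp: nilpotent_def)
  have "qterm G c a b (\<lambda>_. \<one>) = qterm G c b a (\<lambda>_. \<one>)"
    using c(2) ab by (simp add: c_nilpotent_def)
  then show "\<exists>s\<in>carrier G. \<exists>t\<in>carrier G. s \<otimes> a = t \<otimes> b"
    using qterm_last_factor[OF c(1) ab, of "\<lambda>_. \<one>"] by (metis one_closed)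
qed

theorem (in ore_monoid) fractions_engel:
  assumes c: "c \<ge> 1" "c_nilpotent c M"
    and u: "u \<in> carrier fractions" and g: "g \<in> carrier fractions"
  shows "(group.comm fractions u ^^ c) g = \<one>\<^bsub>fractions\<^esub>"
proof -
  interpret F: group fractions by (rule group_fractions)
  let ?S = "frac \<one> ` carrier M"
  have S: "?S \<subseteq> carrier fractions" "\<one>\<^bsub>fractions\<^esub> \<in> ?S"
    by (auto simp: fractions_one[of \<one>])
  have gen: "\<forall>g\<in>carrier fractions. \<exists>a\<in>?S. \<exists>b\<in>?S. g = inv\<^bsub>fractions\<^esub> a \<otimes>\<^bsub>fractions\<^esub> b"
  proof
    fix X assume "X \<in> carrier fractions"
    then obtain a b where "a \<in> carrier M" "b \<in> carrier M" "X = frac a b" by (rule fractions_cases)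
    then show "\<exists>a\<in>?S. \<exists>b\<in>?S. X = inv\<^bsub>fractions\<^esub> a \<otimes>\<^bsub>fractions\<^esub> b"
      using frac_decompose by blast
  qed
  have "{\<one>\<^bsub>fractions\<^esub>} \<lhd> fractions" by (rule F.one_is_normal)
  moreover have "inv\<^bsub>fractions\<^esub> (qterm fractions c y x z) \<otimes>\<^bsub>fractions\<^esub> qterm fractions c x y z
      \<in> {\<one>\<^bsub>fractions\<^esub>}"
    if xyz: "x \<in> ?S" "y \<in> ?S" "\<And>i. z i \<in> ?S" for x y z
  proof -
    obtain a b where ab: "a \<in> carrier M" "b \<in> carrier M" "x = frac \<one> a" "y = frac \<one> b"
      using xyz by blast
    have "\<forall>i. \<exists>d\<in>carrier M. z i = frac \<one> d" using xyz(3) by blast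
    then obtain d where d: "\<And>i. d i \<in> carrier M" "z = (\<lambda>i. frac \<one> (d i))" by metis
    have "qterm M c a b d = qterm M c b a d"
      using c(2) ab d(1) by (simp add: c_nilpotent_def)
    then have "qterm fractions c y x z = qterm fractions c x y z"
      using qterm_frac[OF ab(1,2) d(1) c(1)] qterm_frac[OF ab(2,1) d(1) c(1)] ab d(2) by simp
    moreover have "qterm fractions c x y z \<in> carrier fractions"
      using S(1) xyz by (intro F.qterm_closed[OF c(1)]) blast+
    ultimately show ?thesis by simp
  qed
  ultimately have "(F.comm u ^^ c) g \<in> {\<one>\<^bsub>fractions\<^esub>}"
    by (rule F.engel_of_nilpotent_law[OF S gen c(1) _ _ u g])
  then show ?thesis by simp
qed

section \<open>Orthogonality is preserved under conjugation\<close>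

context prime_filter
begin

text \<open>The assertion \<open>u\<^sup>k \<le>\<^sub>H w u\<^sup>k\<close> says in the group of fractions that \<open>u\<^sup>-\<^sup>k w u\<^sup>k\<close> is above the
  unit for the extension of \<open>\<le>\<^sub>H\<close>, so that \<open>engel_conj_seq_trivial\<close> applies.\<close>

lemma le_mod_powers:
  assumes nil: "nilpotent L" and u: "u \<in> carrier L" and w: "w \<in> carrier L" "w \<preceq> \<one>"
    and inf: "\<And>m. \<exists>k\<ge>m. le_mod (u [^] (k::nat)) (w \<otimes> u [^] k)"
  shows "le_mod (u [^] (k::nat)) (w \<otimes> u [^] k)"
proof -
  interpret O: ore_monoid L by (rule ore_monoid_of_nilpotent[OF nil])
  obtain c where c: "c \<ge> 1" "c_nilpotent c L" using nil by (auto simp: nilpotent_def)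
  let ?G = O.fractions
  interpret F: group ?G by (rule O.group_fractions)
  define Pos where "Pos = {O.frac a b | a b. a \<in> carrier L \<and> b \<in> carrier L \<and> le_mod a b}"
  \<comment> \<open>independent of the representation of the fraction because \<open>\<le>\<^sub>H\<close> is invariant under left multiplication\<close>
  have Pos_iff: "O.frac a b \<in> Pos \<longleftrightarrow> le_mod a b" if ab: "a \<in> carrier L" "b \<in> carrier L" for a b
  proof
    assume "O.frac a b \<in> Pos"
    then obtain a' b' where ab': "a' \<in> carrier L" "b' \<in> carrier L" "le_mod a' b'"
      "O.frac a b = O.frac a' b'" by (auto simp: Pos_def)
    then have "O.same_frac a b a' b'" using O.frac_eq_iff ab by blast
    then obtain s t where st: "s \<in> carrier L" "t \<in> carrier L"
      "s \<otimes> a = t \<otimes> a'" "s \<otimes> b = t \<otimes> b'" unfolding O.same_frac_def by blast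
    have "le_mod (t \<otimes> a') (t \<otimes> b')" using ab' st(2) by (simp add: le_mod_mult_left_iff)
    then have "le_mod (s \<otimes> a) (s \<otimes> b)" by (simp only: st)
    then show "le_mod a b" using ab st(1) by (simp add: le_mod_mult_left_iff)
  qed (use ab in \<open>auto simp: Pos_def\<close>)
  interpret P: preordered_group ?G Pos
  proof unfold_locales
    show "Pos \<subseteq> carrier ?G" by (auto simp: Pos_def)
    show "\<one>\<^bsub>?G\<^esub> \<in> Pos" using Pos_iff[of \<one> \<one>] by (simp add: O.fractions_one[of \<one>] le_imp_le_mod)
  next
    fix X Y assume XY: "X \<in> Pos" "Y \<in> Pos"
    then have "X \<in> carrier ?G" "Y \<in> carrier ?G" by (auto simp: Pos_def)
    then obtain a b d where abd: "a \<in> carrier L" "b \<in> carrier L" "d \<in> carrier L"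
      "X = O.frac a b" "Y = O.frac b d" by (rule O.fractions_common)
    then have "le_mod a d" using XY Pos_iff le_mod_trans by blast
    then show "X \<otimes>\<^bsub>?G\<^esub> Y \<in> Pos" using abd Pos_iff by (simp add: O.frac_mult)
  next
    fix X assume "X \<in> carrier ?G"
    then obtain a b where "a \<in> carrier L" "b \<in> carrier L" "X = O.frac a b"
      by (rule O.fractions_cases)
    then show "X \<in> Pos \<or> inv\<^bsub>?G\<^esub> X \<in> Pos"
      using le_mod_total[of a b] Pos_iff by (simp add: O.inv_frac)
  qed
  let ?u = "O.frac \<one> u" and ?w = "O.frac \<one> w"
  have pow: "?u [^]\<^bsub>?G\<^esub> k = O.frac \<one> (u [^] k)" for k :: nat
    using u by (induction k) (simp_all add: O.frac_one_mult O.fractions_one[of \<one>])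
  have conj: "F.conj_seq ?u ?w k = O.frac (u [^] k) (w \<otimes> u [^] k)" for k
  proof -
    have "F.conj_seq ?u ?w k = O.frac (u [^] k) \<one> \<otimes>\<^bsub>?G\<^esub> (?w \<otimes>\<^bsub>?G\<^esub> O.frac \<one> (u [^] k))"
      using u w by (simp add: F.conj_seq_def pow O.inv_frac F.m_assoc)
    then show ?thesis using u w by (simp add: O.frac_one_mult O.frac_mult)
  qed
  have le: "P.le \<one>\<^bsub>?G\<^esub> (F.conj_seq ?u ?w k) \<longleftrightarrow> le_mod (u [^] k) (w \<otimes> u [^] k)"
    and ge: "P.le (F.conj_seq ?u ?w k) \<one>\<^bsub>?G\<^esub> \<longleftrightarrow> le_mod (w \<otimes> u [^] k) (u [^] k)" for k
    using u w by (simp_all add: P.le_def conj O.inv_frac Pos_iff)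
  have "P.le \<one>\<^bsub>?G\<^esub> (F.conj_seq ?u ?w k)"
  proof (rule P.engel_conj_seq_trivial)
    show "(F.comm ?u ^^ c) ?w = \<one>\<^bsub>?G\<^esub>" using O.fractions_engel[OF c] u w by simp
    show "P.le (F.conj_seq ?u ?w k) \<one>\<^bsub>?G\<^esub>" for k
      unfolding ge using u w by (intro le_imp_le_mod mult_le_right) simp_all
    show "\<exists>k\<ge>m. P.le \<one>\<^bsub>?G\<^esub> (F.conj_seq ?u ?w k)" for m
      unfolding le by (rule inf)
  qed (use u w in simp_all)
  then show ?thesis unfolding le .
qed

lemma orth_conj_mem:
  assumes nil: "nilpotent L" and u: "u \<in> carrier L" and o: "orth x y"
  shows "x \<in> H \<or> le_mod u (y \<otimes> u)"
proof -
  note xy = orthD[OF o]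
  let ?T = "\<lambda>w k. le_mod (u [^] (k::nat)) (w \<otimes> u [^] k)"
  have "?T x k \<or> ?T y k" for k using le_mod_orth[OF o] u by simp
  \<comment> \<open>pigeonhole principle\<close>
  then have "(\<forall>m. \<exists>k\<ge>m. ?T x k) \<or> (\<forall>m. \<exists>k\<ge>m. ?T y k)"
    by (metis nle_le order_trans)
  then show ?thesis
  proof
    assume "\<forall>m. \<exists>k\<ge>m. ?T x k"
    then have "?T x 0" using le_mod_powers[OF nil u, of x] xy by blast
    then obtain h where h: "h \<in> H" "\<one> \<otimes> h \<preceq> x" using xy by (auto simp: le_mod_def)
    then have "x \<in> H" using H_up[OF h(1)] H_subset[OF h(1)] xy by simp
    then show ?thesis ..
  next
    assume "\<forall>m. \<exists>k\<ge>m. ?T y k"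
    then have "?T y 1" using le_mod_powers[OF nil u, of y] xy by blast
    then show ?thesis using u by simp
  qed
qed

end

context prelinear_cancellative_rl
begin

text \<open>The element \<open>(a \ b) \<and> e\<close> is not the unit, so it lies in a maximal ideal \<open>D\<close>. It cannot lie in
  the polar of \<open>D\<close> as well, since then \<open>D\<close> would contain the unit.\<close>

lemma separating_ideal:
  assumes ab: "a \<in> carrier L" "b \<in> carrier L" and nle: "\<not> a \<preceq> b"
  obtains D where "maximal_cone_ideal D" "\<not> prime_filter.le_mod L (polar D) a b"
proof -
  let ?t = "a \<setminus> b \<^bold>\<and> \<one>"
  have "?t \<noteq> \<one>"
  proof
    assume "?t = \<one>"
    then have "\<one> \<preceq> a \<setminus> b" using meet_le(1)[of "a \<setminus> b" \<one>] ab by simp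
    then show False using nle lres_adjoint[of a \<one> b] ab by simp
  qed
  moreover have "?t \<in> carrier L" "?t \<preceq> \<one>" using ab by simp_all
  ultimately obtain D where D: "maximal_cone_ideal D" "?t \<in> D"
    using ex_maximal_cone_ideal by blast
  interpret prime_filter L "polar D" by (rule prime_filter_polar[OF D(1)])
  have ideal: "cone_ideal D" using D(1) by (simp add: maximal_cone_ideal_def)
  have "?t \<notin> polar D"
  proof
    assume "?t \<in> polar D"
    then obtain x where x: "x \<in> D" "x \<^bold>\<or> ?t = \<one>" by (auto simp: polar_def orth_def)
    then have "\<one> \<in> D" using cone_ideal_join[OF ideal x(1) D(2)] by simp
    then show False using cone_idealD(3)[OF ideal] by blast
  qed
  then show ?thesis using that[OF D(1)] le_mod_iff_lres[OF ab] by blast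
qed

text \<open>If \<open>u\<close> is invertible, this says \<open>x \<or> u\<^sup>-\<^sup>1 y u = e\<close>. It holds modulo all prime filters
  that arise as polars of maximal ideals, and these separate elements.\<close>

theorem orth_conj:
  assumes nil: "nilpotent L" and u: "u \<in> carrier L" and o: "orth x y"
  shows "u \<otimes> x \<^bold>\<or> y \<otimes> u = u"
proof -
  note xy = orthD[OF o]
  let ?j = "u \<otimes> x \<^bold>\<or> y \<otimes> u"
  have "u \<preceq> ?j"
  proof (rule ccontr)
    assume "\<not> u \<preceq> ?j"
    moreover have jc: "?j \<in> carrier L" using u xy by simp
    ultimately obtain D where D: "maximal_cone_ideal D" "\<not> prime_filter.le_mod L (polar D) u ?j"
      using separating_ideal[OF u] by blast
    interpret prime_filter L "polar D" by (rule prime_filter_polar[OF D(1)])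
    from orth_conj_mem[OF nil u o] have "le_mod u ?j"
    proof
      assume "x \<in> polar D"
      then show ?thesis unfolding le_mod_def using u xy by (intro bexI[of _ x]) simp_all
    next
      assume "le_mod u (y \<otimes> u)"
      then show ?thesis
        using le_mod_trans[OF _ le_imp_le_mod[OF join_ge(2)[of "u \<otimes> x" "y \<otimes> u"]]] u xy jc by simp
    qed
    then show False using D(2) by simp
  qed
  moreover have "?j \<preceq> u" using u xy by (simp add: join_le_iff mult_le_left mult_le_right)
  ultimately show ?thesis using le_antisym u xy by simp
qed

end

section \<open>Normal prime filters\<close>

locale normal_prime_filter = prime_filter +
  assumes normal_left: "\<lbrakk>h \<in> H; u \<in> carrier L\<rbrakk> \<Longrightarrow> \<exists>s\<in>H. u \<otimes> s \<preceq> h \<otimes> u"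
    and normal_right: "\<lbrakk>h \<in> H; u \<in> carrier L\<rbrakk> \<Longrightarrow> \<exists>s\<in>H. s \<otimes> u \<preceq> u \<otimes> h"

text \<open>Let \<open>x \<in> D\<close> be orthogonal to \<open>h\<close>, so that \<open>u = u x \<or> h u\<close>. The elements
  \<open>s = (u x \ h u) \<and> e\<close> and \<open>t = (h u \ u x) \<and> e\<close> are orthogonal by prelinearity. Distributing
  them over the join gives \<open>u s \<le> h u\<close>, which is the required inequality, and \<open>u t \<le> u x\<close>, hence
  \<open>t \<le> x\<close>. So \<open>s\<close> is orthogonal to \<open>x\<close> and belongs to the polar of \<open>D\<close>. The pair \<open>s\<close>,
  \<open>t\<close> makes up for the conjugate \<open>u\<^sup>-\<^sup>1 h u\<close>, which need not exist in \<open>L\<close>. The other inequality is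
  the mirror image, starting from \<open>u = u h \<or> x u\<close>.\<close>

theorem (in prelinear_cancellative_rl) normal_prime_filter_polar:
  assumes nil: "nilpotent L" and D: "maximal_cone_ideal D"
  shows "normal_prime_filter L (polar D)"
proof -
  interpret prime_filter L "polar D" by (rule prime_filter_polar[OF D])
  show ?thesis
  proof unfold_locales
    fix h u assume h: "h \<in> polar D" and u: "u \<in> carrier L"
    obtain x where x: "x \<in> D" and o: "orth x h" using h by (auto simp: polar_def)
    note xh = orthD[OF o]
    let ?a = "u \<otimes> x" and ?b = "h \<otimes> u"
    have ab: "?a \<in> carrier L" "?b \<in> carrier L" using u xh by simp_all
    let ?s = "?a \<setminus> ?b \<^bold>\<and> \<one>" and ?t = "?b \<setminus> ?a \<^bold>\<and> \<one>"
    have st: "?s \<in> carrier L" "?t \<in> carrier L" "?s \<preceq> \<one>" "?t \<preceq> \<one>" using ab by simp_all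
    have j: "?a \<^bold>\<or> ?b = u" by (rule orth_conj[OF nil u o])
    have "?a \<otimes> ?s \<preceq> ?b" "?b \<otimes> ?t \<preceq> ?a" using ab by (simp_all add: lres_adjoint)
    moreover have "?b \<otimes> ?s \<preceq> ?b" "?a \<otimes> ?t \<preceq> ?a" using ab st by (simp_all only: mult_le_left)
    ultimately have us: "u \<otimes> ?s \<preceq> ?b" and ut: "u \<otimes> ?t \<preceq> ?a"
      using mult_join_le_iff(2)[OF ab ab(2) st(1)] mult_join_le_iff(2)[OF ab ab(1) st(2)]
      unfolding j by blast+
    have tx: "?t \<preceq> x" using ut mult_le_cancel_left[OF st(2) _ u, of x] xh by simp
    have "orth ?s ?t" using lres_prelinear[OF ab] st by (simp add: orth_def)
    then have "orth x ?s" using orth_mono[OF _ tx] xh orth_sym by blast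
    then have "?s \<in> polar D" using x by (auto simp: polar_def)
    then show "\<exists>s\<in>polar D. u \<otimes> s \<preceq> h \<otimes> u" using us by blast
  next
    fix h u assume h: "h \<in> polar D" and u: "u \<in> carrier L"
    obtain x where x: "x \<in> D" and o: "orth x h" using h by (auto simp: polar_def)
    note xh = orthD[OF o]
    let ?a = "x \<otimes> u" and ?b = "u \<otimes> h"
    have ab: "?a \<in> carrier L" "?b \<in> carrier L" using u xh by simp_all
    let ?s = "?b \<^bold>/ ?a \<^bold>\<and> \<one>" and ?t = "?a \<^bold>/ ?b \<^bold>\<and> \<one>"
    have st: "?s \<in> carrier L" "?t \<in> carrier L" "?s \<preceq> \<one>" "?t \<preceq> \<one>" using ab by simp_all
    have j: "?b \<^bold>\<or> ?a = u" by (rule orth_conj[OF nil u orth_sym[OF o]])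
    have "?s \<otimes> ?a \<preceq> ?b" "?t \<otimes> ?b \<preceq> ?a" using ab by (simp_all add: rres_adjoint)
    moreover have "?s \<otimes> ?b \<preceq> ?b" "?t \<otimes> ?a \<preceq> ?a" using ab st by (simp_all only: mult_le_right)
    ultimately have us: "?s \<otimes> u \<preceq> ?b" and ut: "?t \<otimes> u \<preceq> ?a"
      using mult_join_le_iff(1)[OF ab(2,1,2) st(1)] mult_join_le_iff(1)[OF ab(2,1,1) st(2)]
      unfolding j by blast+
    have tx: "?t \<preceq> x" using ut mult_le_cancel_right[OF st(2) _ u, of x] xh by simp
    have "orth ?s ?t" using rres_prelinear[OF ab(2,1)] st by (simp add: orth_def)
    then have "orth x ?s" using orth_mono[OF _ tx] xh orth_sym by blast
    then have "?s \<in> polar D" using x by (auto simp: polar_def)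
    then show "\<exists>s\<in>polar D. s \<otimes> u \<preceq> u \<otimes> h" using us by blast
  qed
qed

section \<open>The quotient by a normal prime filter\<close>

context normal_prime_filter
begin

text \<open>By normality the factor from \<open>H\<close> can be moved to the other side. So \<open>\<le>\<^sub>H\<close> satisfies both
  adjunctions, from which its compatibility with multiplication and with the residuals follows.\<close>

lemma le_mod_iff_left_mult:
  assumes "a \<in> carrier L" "b \<in> carrier L"
  shows "le_mod a b \<longleftrightarrow> (\<exists>h\<in>H. h \<otimes> a \<preceq> b)"
proof
  assume "le_mod a b"
  then obtain h where h: "h \<in> H" "a \<otimes> h \<preceq> b" by (auto simp: le_mod_def)
  obtain s where s: "s \<in> H" "s \<otimes> a \<preceq> a \<otimes> h" using normal_right[OF h(1) assms(1)] by blast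
  have "s \<otimes> a \<preceq> b"
    using le_trans[OF s(2) h(2)] H_subset[OF h(1)] H_subset[OF s(1)] assms by simp
  then show "\<exists>h\<in>H. h \<otimes> a \<preceq> b" using s(1) by blast
next
  assume "\<exists>h\<in>H. h \<otimes> a \<preceq> b"
  then obtain h where h: "h \<in> H" "h \<otimes> a \<preceq> b" by blast
  obtain s where s: "s \<in> H" "a \<otimes> s \<preceq> h \<otimes> a" using normal_left[OF h(1) assms(1)] by blast
  have "a \<otimes> s \<preceq> b"
    using le_trans[OF s(2) h(2)] H_subset[OF h(1)] H_subset[OF s(1)] assms by simp
  then show "le_mod a b" using s(1) by (auto simp: le_mod_def)
qed

lemma le_mod_lres_adjoint:
  assumes "a \<in> carrier L" "b \<in> carrier L" "d \<in> carrier L"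
  shows "le_mod (a \<otimes> b) d \<longleftrightarrow> le_mod b (a \<setminus> d)"
proof -
  have "a \<otimes> b \<otimes> h \<preceq> d \<longleftrightarrow> b \<otimes> h \<preceq> a \<setminus> d" if "h \<in> H" for h
    using lres_adjoint[of a "b \<otimes> h" d] assms H_subset[OF that] by (simp add: m_assoc)
  then show ?thesis by (auto simp: le_mod_def)
qed

lemma le_mod_rres_adjoint:
  assumes "a \<in> carrier L" "b \<in> carrier L" "d \<in> carrier L"
  shows "le_mod (a \<otimes> b) d \<longleftrightarrow> le_mod a (d \<^bold>/ b)"
proof -
  have "h \<otimes> (a \<otimes> b) \<preceq> d \<longleftrightarrow> h \<otimes> a \<preceq> d \<^bold>/ b" if "h \<in> H" for h
    using rres_adjoint[of "h \<otimes> a" b d] assms H_subset[OF that] by (simp add: m_assoc)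
  then show ?thesis using assms by (auto simp: le_mod_iff_left_mult)
qed

lemma le_mod_meet_iff:
  assumes "a \<in> carrier L" "b \<in> carrier L" "d \<in> carrier L"
  shows "le_mod d (a \<^bold>\<and> b) \<longleftrightarrow> le_mod d a \<and> le_mod d b"
proof
  assume "le_mod d a \<and> le_mod d b"
  then obtain h k where hk: "h \<in> H" "d \<otimes> h \<preceq> a" "k \<in> H" "d \<otimes> k \<preceq> b" by (auto simp: le_mod_def)
  note carr = H_subset[OF hk(1)] H_subset[OF hk(3)] assms
  have "d \<otimes> (h \<otimes> k) \<preceq> d \<otimes> h" "d \<otimes> (h \<otimes> k) \<preceq> d \<otimes> k"
    using carr by (simp_all add: mult_left_mono mult_le_left mult_le_right)
  then have "d \<otimes> (h \<otimes> k) \<preceq> a \<^bold>\<and> b"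
    using carr le_trans[OF _ hk(2)] le_trans[OF _ hk(4)] by (simp add: le_meet_iff)
  then show "le_mod d (a \<^bold>\<and> b)" using H_mult[OF hk(1,3)] by (auto simp: le_mod_def)
qed (use assms le_mod_trans[OF _ le_imp_le_mod[OF meet_le(1)[of a b]]]
    le_mod_trans[OF _ le_imp_le_mod[OF meet_le(2)[of a b]]] in simp)

lemma le_mod_join_iff:
  assumes "a \<in> carrier L" "b \<in> carrier L" "d \<in> carrier L"
  shows "le_mod (a \<^bold>\<or> b) d \<longleftrightarrow> le_mod a d \<and> le_mod b d"
proof
  assume "le_mod a d \<and> le_mod b d"
  then have "le_mod \<one> (a \<setminus> d \<^bold>\<and> b \<setminus> d)"
    using assms le_mod_lres_adjoint[of a \<one> d] le_mod_lres_adjoint[of b \<one> d] by (simp add: le_mod_meet_iff)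
  then obtain h where h: "h \<in> H" "\<one> \<otimes> h \<preceq> a \<setminus> d \<^bold>\<and> b \<setminus> d" by (auto simp: le_mod_def)
  then have "a \<otimes> h \<preceq> d" "b \<otimes> h \<preceq> d"
    using H_subset[OF h(1)] assms by (simp_all add: le_meet_iff lres_adjoint)
  then have "(a \<^bold>\<or> b) \<otimes> h \<preceq> d"
    using H_subset[OF h(1)] assms by (simp add: mult_join_le_iff)
  then show "le_mod (a \<^bold>\<or> b) d" using h(1) by (auto simp: le_mod_def)
qed (use assms le_mod_trans[OF le_imp_le_mod[OF join_ge(1)[of a b]]]
    le_mod_trans[OF le_imp_le_mod[OF join_ge(2)[of a b]]] in simp)

lemma le_mod_refl: "a \<in> carrier L \<Longrightarrow> le_mod a a"
  by (simp add: le_imp_le_mod)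

lemma le_mod_mult_mono:
  assumes "le_mod a a'" "le_mod b b'" and c: "a \<in> carrier L" "a' \<in> carrier L" "b \<in> carrier L" "b' \<in> carrier L"
  shows "le_mod (a \<otimes> b) (a' \<otimes> b')"
proof (rule le_mod_trans)
  have "le_mod a' ((a' \<otimes> b) \<^bold>/ b)" using c le_mod_refl by (simp flip: le_mod_rres_adjoint)
  then have "le_mod a ((a' \<otimes> b) \<^bold>/ b)" using le_mod_trans[OF assms(1)] c by simp
  then show "le_mod (a \<otimes> b) (a' \<otimes> b)" using c by (simp add: le_mod_rres_adjoint)
  show "le_mod (a' \<otimes> b) (a' \<otimes> b')" using c assms(2) by (simp add: le_mod_mult_left_iff)
qed (use c in simp_all)

lemma le_mod_meet_mono:
  assumes "le_mod a a'" "le_mod b b'" and c: "a \<in> carrier L" "a' \<in> carrier L" "b \<in> carrier L" "b' \<in> carrier L"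
  shows "le_mod (a \<^bold>\<and> b) (a' \<^bold>\<and> b')"
  using assms le_mod_trans[OF le_imp_le_mod[OF meet_le(1)[OF c(1,3)]] assms(1)]
    le_mod_trans[OF le_imp_le_mod[OF meet_le(2)[OF c(1,3)]] assms(2)] by (simp add: le_mod_meet_iff)

lemma le_mod_join_mono:
  assumes "le_mod a a'" "le_mod b b'" and c: "a \<in> carrier L" "a' \<in> carrier L" "b \<in> carrier L" "b' \<in> carrier L"
  shows "le_mod (a \<^bold>\<or> b) (a' \<^bold>\<or> b')"
  using assms le_mod_trans[OF assms(1) le_imp_le_mod[OF join_ge(1)[OF c(2,4)]]]
    le_mod_trans[OF assms(2) le_imp_le_mod[OF join_ge(2)[OF c(2,4)]]] by (simp add: le_mod_join_iff)

lemma le_mod_lres_mono: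
  assumes "le_mod a' a" "le_mod b b'" and c: "a \<in> carrier L" "a' \<in> carrier L" "b \<in> carrier L" "b' \<in> carrier L"
  shows "le_mod (a \<setminus> b) (a' \<setminus> b')"
proof -
  have "le_mod (a' \<otimes> (a \<setminus> b)) (a \<otimes> (a \<setminus> b))"
    using c assms(1) le_mod_refl by (simp add: le_mod_mult_mono)
  moreover have "le_mod (a \<otimes> (a \<setminus> b)) b" using c by (simp add: le_imp_le_mod lres_mult_le)
  ultimately have "le_mod (a' \<otimes> (a \<setminus> b)) b'"
    using le_mod_trans[OF le_mod_trans assms(2)] c by simp
  then show ?thesis using c by (simp add: le_mod_lres_adjoint)
qed

lemma le_mod_rres_mono:
  assumes "le_mod a' a" "le_mod b b'" and c: "a \<in> carrier L" "a' \<in> carrier L" "b \<in> carrier L" "b' \<in> carrier L"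
  shows "le_mod (b \<^bold>/ a) (b' \<^bold>/ a')"
proof -
  have "le_mod ((b \<^bold>/ a) \<otimes> a') ((b \<^bold>/ a) \<otimes> a)"
    using c assms(1) by (simp add: le_mod_mult_left_iff)
  moreover have "le_mod ((b \<^bold>/ a) \<otimes> a) b" using c by (simp add: le_imp_le_mod rres_mult_le)
  ultimately have "le_mod ((b \<^bold>/ a) \<otimes> a') b'"
    using le_mod_trans[OF le_mod_trans assms(2)] c by simp
  then show ?thesis using c by (simp add: le_mod_rres_adjoint)
qed

definition le_class :: "'a \<Rightarrow> 'a set" where "le_class a = {b \<in> carrier L. le_mod a b \<and> le_mod b a}"

definition rep :: "'a set \<Rightarrow> 'a" where "rep X = (SOME a. a \<in> X)"

definition quot :: "'a set residuated_lattice" where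
  "quot = \<lparr>
     carrier = le_class ` carrier L,
     mult = (\<lambda>X Y. le_class (rep X \<otimes> rep Y)),
     one = le_class \<one>,
     rl_meet = (\<lambda>X Y. le_class (rep X \<^bold>\<and> rep Y)),
     rl_join = (\<lambda>X Y. le_class (rep X \<^bold>\<or> rep Y)),
     lres = (\<lambda>X Y. le_class (rep X \<setminus> rep Y)),
     rres = (\<lambda>X Y. le_class (rep X \<^bold>/ rep Y))\<rparr>"

lemma le_class_eq_iff:
  assumes ab: "a \<in> carrier L" "b \<in> carrier L"
  shows "le_class a = le_class b \<longleftrightarrow> le_mod a b \<and> le_mod b a"
proof
  assume "le_class a = le_class b"
  moreover have "a \<in> le_class a" using ab le_mod_refl by (simp add: le_class_def)
  ultimately have "a \<in> le_class b" by simp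
  then show "le_mod a b \<and> le_mod b a" by (simp add: le_class_def)
next
  assume l: "le_mod a b \<and> le_mod b a"
  have "x \<in> le_class a \<longleftrightarrow> x \<in> le_class b" for x
    using l ab le_mod_trans[of x a b] le_mod_trans[of x b a] le_mod_trans[of a b x] le_mod_trans[of b a x]
    unfolding le_class_def by blast
  then show "le_class a = le_class b" by blast
qed

lemma rep_le_class:
  assumes "a \<in> carrier L"
  shows "rep (le_class a) \<in> carrier L" "le_mod a (rep (le_class a))" "le_mod (rep (le_class a)) a"
proof -
  have "a \<in> le_class a" using assms le_mod_refl by (simp add: le_class_def)
  then have "rep (le_class a) \<in> le_class a" unfolding rep_def by (rule someI)
  then show "rep (le_class a) \<in> carrier L" "le_mod a (rep (le_class a))" "le_mod (rep (le_class a)) a"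
    by (simp_all add: le_class_def)
qed

lemma quot_carrier: "carrier quot = le_class ` carrier L" and quot_one: "\<one>\<^bsub>quot\<^esub> = le_class \<one>"
  by (simp_all add: quot_def)

lemma quot_ops:
  assumes ab: "a \<in> carrier L" "b \<in> carrier L"
  shows "le_class a \<otimes>\<^bsub>quot\<^esub> le_class b = le_class (a \<otimes> b)"
    and "le_class a \<^bold>\<and>\<^bsub>quot\<^esub> le_class b = le_class (a \<^bold>\<and> b)"
    and "le_class a \<^bold>\<or>\<^bsub>quot\<^esub> le_class b = le_class (a \<^bold>\<or> b)"
    and "le_class a \<setminus>\<^bsub>quot\<^esub> le_class b = le_class (a \<setminus> b)"
    and "le_class a \<^bold>/\<^bsub>quot\<^esub> le_class b = le_class (a \<^bold>/ b)"
  using ab rep_le_class[OF ab(1)] rep_le_class[OF ab(2)]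
  by (simp_all add: quot_def le_class_eq_iff le_mod_mult_mono le_mod_meet_mono le_mod_join_mono
      le_mod_lres_mono le_mod_rres_mono)

lemma quot_le:
  assumes "a \<in> carrier L" "b \<in> carrier L"
  shows "le_class a \<preceq>\<^bsub>quot\<^esub> le_class b \<longleftrightarrow> le_mod a b"
  using assms le_mod_refl
  by (auto simp: rl_le_def[of quot] quot_ops le_class_eq_iff le_mod_meet_iff le_imp_le_mod)

lemma residuated_lattice_quot: "residuated_lattice quot"
proof -
  have assoc: "(a \<otimes> b) \<otimes> d = a \<otimes> (b \<otimes> d)" "(a \<^bold>\<and> b) \<^bold>\<and> d = a \<^bold>\<and> (b \<^bold>\<and> d)"
    "(a \<^bold>\<or> b) \<^bold>\<or> d = a \<^bold>\<or> (b \<^bold>\<or> d)"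
    if "a \<in> carrier L" "b \<in> carrier L" "d \<in> carrier L" for a b d
    using that by (simp_all only: m_assoc meet_assoc join_assoc)
  have comm: "le_class (a \<^bold>\<and> b) = le_class (b \<^bold>\<and> a)" "le_class (a \<^bold>\<or> b) = le_class (b \<^bold>\<or> a)"
    if "a \<in> carrier L" "b \<in> carrier L" for a b
    using that by (simp_all only: meet_comm[of a b] join_comm[of a b])
  show ?thesis
  proof (unfold_locales, goal_cases)
    case (8 a b)
    then show ?case by (auto simp: quot_carrier quot_ops)
  qed (auto simp: quot_carrier quot_one quot_ops quot_le assoc comm meet_absorb join_absorb
      simp flip: le_mod_lres_adjoint le_mod_rres_adjoint)
qed

lemma totally_ordered_quot: "totally_ordered quot"
  using le_mod_total by (auto simp: totally_ordered_def quot_carrier quot_le)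

end

section \<open>Semilinearity\<close>

lemma subdirect_of_chains_if_separating:
  assumes chain: "\<And>i. i \<in> I \<Longrightarrow> residuated_lattice (F i) \<and> totally_ordered (F i)"
    and onto: "\<And>i. i \<in> I \<Longrightarrow> p i ` carrier L = carrier (F i)"
    and one: "\<And>i. i \<in> I \<Longrightarrow> p i \<one>\<^bsub>L\<^esub> = \<one>\<^bsub>F i\<^esub>"
    and ops: "\<And>i a b. \<lbrakk>i \<in> I; a \<in> carrier L; b \<in> carrier L\<rbrakk> \<Longrightarrow>
      p i (a \<otimes>\<^bsub>L\<^esub> b) = p i a \<otimes>\<^bsub>F i\<^esub> p i b \<and>
      p i (a \<^bold>\<and>\<^bsub>L\<^esub> b) = p i a \<^bold>\<and>\<^bsub>F i\<^esub> p i b \<and>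
      p i (a \<^bold>\<or>\<^bsub>L\<^esub> b) = p i a \<^bold>\<or>\<^bsub>F i\<^esub> p i b \<and>
      p i (a \<setminus>\<^bsub>L\<^esub> b) = p i a \<setminus>\<^bsub>F i\<^esub> p i b \<and>
      p i (a \<^bold>/\<^bsub>L\<^esub> b) = p i a \<^bold>/\<^bsub>F i\<^esub> p i b"
    and separating: "\<And>a b. \<lbrakk>a \<in> carrier L; b \<in> carrier L; a \<noteq> b\<rbrakk> \<Longrightarrow> \<exists>i\<in>I. p i a \<noteq> p i b"
    and L: "residuated_lattice L"
  shows "subdirect_of_chains L I F"
proof -
  interpret L: residuated_lattice L by (rule L)
  define h where "h a = (\<lambda>i\<in>I. p i a)" for a
  let ?P = "rl_product I F"
  have h_one: "h \<one>\<^bsub>L\<^esub> = \<one>\<^bsub>?P\<^esub>"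
    using one by (auto simp: h_def rl_product_def intro!: restrict_ext)
  have h_ops: "h (a \<otimes>\<^bsub>L\<^esub> b) = h a \<otimes>\<^bsub>?P\<^esub> h b" "h (a \<^bold>\<and>\<^bsub>L\<^esub> b) = h a \<^bold>\<and>\<^bsub>?P\<^esub> h b"
    "h (a \<^bold>\<or>\<^bsub>L\<^esub> b) = h a \<^bold>\<or>\<^bsub>?P\<^esub> h b" "h (a \<setminus>\<^bsub>L\<^esub> b) = h a \<setminus>\<^bsub>?P\<^esub> h b"
    "h (a \<^bold>/\<^bsub>L\<^esub> b) = h a \<^bold>/\<^bsub>?P\<^esub> h b"
    if "a \<in> carrier L" "b \<in> carrier L" for a b
    using ops that by (auto simp: h_def rl_product_def intro!: restrict_ext)
  have closed: "h a \<in> carrier ?P" if "a \<in> carrier L" for a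
    using onto that by (auto simp: h_def rl_product_def)
  have "subuniverse (h ` carrier L) ?P"
    unfolding subuniverse_def using closed
    by (auto simp: h_one[symmetric] h_ops[symmetric])
  moreover have "(\<lambda>f. f i) ` h ` carrier L = carrier (F i)" if "i \<in> I" for i
    using onto[OF that] that by (simp add: image_image h_def)
  ultimately have "subdirect (h ` carrier L) I F" by (simp add: subdirect_def)
  moreover have "inj_on h (carrier L)"
  proof (rule inj_onI, rule ccontr)
    fix a b assume ab: "a \<in> carrier L" "b \<in> carrier L" "h a = h b" "a \<noteq> b"
    then obtain i where "i \<in> I" "p i a \<noteq> p i b" using separating by blast
    then show False using fun_cong[OF ab(3), of i] by (simp add: h_def)
  qed
  then have "h \<in> rl_iso L (?P\<lparr>carrier := h ` carrier L\<rparr>)"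
    by (simp add: rl_iso_def bij_betw_def h_one h_ops)
  ultimately show ?thesis using chain by (auto simp: subdirect_of_chains_def)
qed

theorem theorem6p3:
  fixes L :: "('a, 'm) residuated_lattice_scheme"
  assumes "residuated_lattice L" and "monoid_cancel L" and "prelinear L" and "nilpotent L"
  shows "semilinear L"
proof -
  interpret residuated_lattice L by (rule assms(1))
  interpret monoid_cancel L by (rule assms(2))
  interpret prelinear_cancellative_rl L by unfold_locales (rule assms(3))
  let ?I = "{D. maximal_cone_ideal D}"
  let ?Q = "\<lambda>D. normal_prime_filter.quot L (polar D)"
  let ?p = "\<lambda>D. normal_prime_filter.le_class L (polar D)"
  have normal: "normal_prime_filter L (polar D)" if "D \<in> ?I" for D
    using normal_prime_filter_polar[OF assms(4)] that by simp
  note npf = normal_prime_filter.residuated_lattice_quot[OF normal]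
    normal_prime_filter.totally_ordered_quot[OF normal]
    normal_prime_filter.quot_carrier[OF normal] normal_prime_filter.quot_one[OF normal]
    normal_prime_filter.quot_ops[OF normal] normal_prime_filter.le_class_eq_iff[OF normal]
  have "subdirect_of_chains L ?I ?Q"
  proof (rule subdirect_of_chains_if_separating[where p = ?p])
    fix a b assume ab: "a \<in> carrier L" "b \<in> carrier L" "a \<noteq> b"
    have sep: "\<exists>D\<in>?I. ?p D x \<noteq> ?p D y"
      if xy: "x \<in> carrier L" "y \<in> carrier L" "\<not> x \<preceq>\<^bsub>L\<^esub> y" for x y
    proof -
      obtain D where D: "maximal_cone_ideal D" "\<not> prime_filter.le_mod L (polar D) x y"
        using separating_ideal[OF xy] by blast
      then have "?p D x \<noteq> ?p D y" using npf(10)[of D x y] xy by simp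
      then show ?thesis using D(1) by blast
    qed
    have "\<not> a \<preceq>\<^bsub>L\<^esub> b \<or> \<not> b \<preceq>\<^bsub>L\<^esub> a" using le_antisym ab by blast
    then show "\<exists>D\<in>?I. ?p D a \<noteq> ?p D b" using sep[of a b] sep[of b a] ab by metis
  qed (simp_all add: npf assms(1))
  then show ?thesis by (rule semilinearI[OF assms(1)])
qed

end
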